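(* Let $\mathcal{A}$ be an abelian category and $\mathcal{C} \subset \mathcal{A}$ a localizing subcategory. Each Gabriel monad (with respect to $\mathcal{C}$) is a $\mathcal{C}$-saturating monad. Conversely, each $\mathcal{C}$-saturating monad is equivalent to a Gabriel monad (with respect to $\mathcal{C}$).
   Context: Composition of functors is written $\mathscr{G}\circ\mathscr{F}$ (first $\mathscr{F}$, then $\mathscr{G}$); for a natural transformation $\eta$ and a functor $\mathscr{F}$, $\mathscr{F}\eta$ and $\eta\mathscr{F}$ denote whiskerings. Thick subcategory: a non-empty full subcategory $\mathcal{C}$ of the abelian category $\mathcal{A}$ such that for every short exact sequence $0\to M'\to M\to M''\to 0$ in $\mathcal{A}$ the object $M$ lies in $\mathcal{C}$ if and only if $M'$ and $M''$ lie in $\mathcal{C}$. Serre quotient: for $\mathcal{C}$ thick, $\mathcal{A}/\mathcal{C}$ is the category with the same objects as $\mathcal{A}$ and $\operatorname{Hom}_{\mathcal{A}/\mathcal{C}}(M,N)=\varinjlim_{M',N'}\operatorname{Hom}_{\mathcal{A}}(M',N/N')$, the limit over all subobjects $M'\le M$, $N'\le N$ with $M/M'\in\mathcal{C}$, $N'\in\mathcal{C}$. The canonical functor $\mathscr{Q}:\mathcal{A}\to\mathcal{A}/\mathcal{C}$ is the identity on objects and sends a morphism to its class in the direct limit. The category $\mathcal{A}/\mathcal{C}$ is abelian and $\mathscr{Q}$ is exact. Universal property: every exact functor $\mathscr{G}:\mathcal{A}\to\mathcal{D}$ into an abelian category with $\mathscr{G}(\mathcal{C})=0$ factors as $\mathscr{G}=\mathscr{H}\circ\mathscr{Q}$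 for a unique functor $\mathscr{H}:\mathcal{A}/\mathcal{C}\to\mathcal{D}$. Localizing subcategory, section functor, Gabriel monad: a thick subcategory $\mathcal{C}$ is localizing if $\mathscr{Q}$ admits a right adjoint $\mathscr{S}:\mathcal{A}/\mathcal{C}\to\mathcal{A}$, called a section functor of $\mathscr{Q}$. With $\eta:\operatorname{Id}_{\mathcal{A}}\to\mathscr{S}\circ\mathscr{Q}$ the unit and $\delta:\mathscr{Q}\circ\mathscr{S}\to\operatorname{Id}_{\mathcal{A}/\mathcal{C}}$ the counit of the adjunction, the associated monad $(\mathscr{S}\circ\mathscr{Q},\eta,\mathscr{S}\delta\mathscr{Q})$ (endofunctor, unit, multiplication) is called the Gabriel monad. $\mathcal{C}$-saturated objects: an object $M$ of $\mathcal{A}$ is $\mathcal{C}$-saturated if it has no non-trivial subobject in $\mathcal{C}$ and every short exact sequence $0\to M\to E\to C\to 0$ in $\mathcal{A}$ with $C\in\mathcal{C}$ splits. $\operatorname{Sat}_{\mathcal{C}}(\mathcal{A})$ denotes the full (replete) subcategory of $\mathcal{C}$-saturated objects and $\iota:\operatorname{Sat}_{\mathcal{C}}(\mathcal{A})\hookrightarrow\mathcal{A}$ its full embedding. For $\mathcal{C}$ localizing, $\operatorname{Sat}_{\mathcal{C}}(\mathcal{A})$ is an abelian category (equivalent to $\mathcal{A}/\mathcal{C}$); exactness of functors into it refers to this abelian structure, not to exactness in $\mathcal{A}$. $\mathcal{C}$-saturating endofunctor: for $\mathcal{C}$ localizing, an endofunctor $\mathscr{W}:\mathcal{A}\to\mathcal{A}$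 together with a natural transformation $\widetilde{\eta}:\operatorname{Id}_{\mathcal{A}}\to\mathscr{W}$ is $\mathcal{C}$-saturating if (1) $\mathcal{C}\subset\ker\mathscr{W}$ (i.e. $\mathscr{W}(C)=0$ for $C\in\mathcal{C}$); (2) $\mathscr{W}(\mathcal{A})\subset\operatorname{Sat}_{\mathcal{C}}(\mathcal{A})$; (3) the corestriction $\mathscr{G}:\mathcal{A}\to\operatorname{Sat}_{\mathcal{C}}(\mathcal{A})$ of $\mathscr{W}$ is exact; (4) $\widetilde{\eta}\mathscr{W}=\mathscr{W}\widetilde{\eta}$; (5) $\widetilde{\eta}\iota$ is a natural isomorphism, i.e. $\widetilde{\eta}_M:M\to\mathscr{W}(M)$ is an isomorphism for every $\mathcal{C}$-saturated $M$. Let $\mathscr{H}:\mathcal{A}/\mathcal{C}\to\operatorname{Sat}_{\mathcal{C}}(\mathcal{A})$ be the unique functor with $\mathscr{G}=\mathscr{H}\circ\mathscr{Q}$; the functor $\widetilde{\mathscr{H}}:=\iota\circ\mathscr{H}$ is called the colift of $\mathscr{W}$ along $\mathscr{Q}$, so $\mathscr{W}=\widetilde{\mathscr{H}}\circ\mathscr{Q}$. $\mathcal{C}$-saturating monad: for a $\mathcal{C}$-saturating endofunctor $(\mathscr{W},\widetilde{\eta})$ with colift $\widetilde{\mathscr{H}}$ there is a natural transformation $\widetilde{\delta}:\mathscr{Q}\circ\widetilde{\mathscr{H}}\to\operatorname{Id}_{\mathcal{A}/\mathcal{C}}$ such that $\mathscr{Q}\dashv\widetilde{\mathscr{H}}$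 is an adjoint pair with unit $\widetilde{\eta}$ and counit $\widetilde{\delta}$. The monad $(\mathscr{W},\widetilde{\eta},\widetilde{\mathscr{H}}\widetilde{\delta}\mathscr{Q})$ associated to this adjunction is called a $\mathcal{C}$-saturating monad. Equivalence of monads on $\mathcal{A}$ means isomorphism of monads: a natural isomorphism of the underlying endofunctors compatible with units and multiplications. *)

theory Defs
  imports "HOL-Algebra.Group"
begin

section \<open>Categories\<close>

text \<open>
  Categories are carrier-based, in the style of HOL-Algebra: only the elements of \<open>Obj\<close> and
  \<open>Arr\<close> matter, and every notion below is relative to these carriers. The composite \<open>g \<cdot> f\<close> means
  first \<open>f\<close>, then \<open>g\<close>.
\<close>

record ('o, 'a) cat =
  Obj :: "'o set"
  Arr :: "'a set"
  Dom :: "'a \<Rightarrow> 'o"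
  Cod :: "'a \<Rightarrow> 'o"
  Ident :: "'o \<Rightarrow> 'a"
  Comp :: "'a \<Rightarrow> 'a \<Rightarrow> 'a" (infixl \<open>\<cdot>\<index>\<close> 70)

definition Hom :: "('o, 'a) cat \<Rightarrow> 'o \<Rightarrow> 'o \<Rightarrow> 'a set" where
  "Hom A x y = {f \<in> Arr A. Dom A f = x \<and> Cod A f = y}"

locale category =
  fixes A :: "('o, 'a) cat" (structure)
  assumes Dom_closed: "f \<in> Arr A \<Longrightarrow> Dom A f \<in> Obj A"
    and Cod_closed: "f \<in> Arr A \<Longrightarrow> Cod A f \<in> Obj A"
    and Ident_closed: "x \<in> Obj A \<Longrightarrow> Ident A x \<in> Hom A x x"
    and Comp_closed: "f \<in> Hom A x y \<Longrightarrow> g \<in> Hom A y z \<Longrightarrow> g \<cdot> f \<in> Hom A x z"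
    and Comp_Ident: "f \<in> Hom A x y \<Longrightarrow> f \<cdot> Ident A x = f"
    and Ident_Comp: "f \<in> Hom A x y \<Longrightarrow> Ident A y \<cdot> f = f"
    and Comp_assoc: "f \<in> Hom A w x \<Longrightarrow> g \<in> Hom A x y \<Longrightarrow> h \<in> Hom A y z \<Longrightarrow>
      h \<cdot> (g \<cdot> f) = (h \<cdot> g) \<cdot> f"

definition full_subcategory :: "('o, 'a) cat \<Rightarrow> 'o set \<Rightarrow> ('o, 'a) cat" where
  "full_subcategory A S = A\<lparr>Obj := S, Arr := {f \<in> Arr A. Dom A f \<in> S \<and> Cod A f \<in> S}\<rparr>"

definition is_iso :: "('o, 'a) cat \<Rightarrow> 'a \<Rightarrow> bool" where
  "is_iso A f \<longleftrightarrow> f \<in> Arr A \<and>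
     (\<exists>g \<in> Hom A (Cod A f) (Dom A f).
        g \<cdot>\<^bsub>A\<^esub> f = Ident A (Dom A f) \<and> f \<cdot>\<^bsub>A\<^esub> g = Ident A (Cod A f))"

definition is_mono :: "('o, 'a) cat \<Rightarrow> 'a \<Rightarrow> bool" where
  "is_mono A f \<longleftrightarrow> f \<in> Arr A \<and>
     (\<forall>x. \<forall>g \<in> Hom A x (Dom A f). \<forall>h \<in> Hom A x (Dom A f).
        f \<cdot>\<^bsub>A\<^esub> g = f \<cdot>\<^bsub>A\<^esub> h \<longrightarrow> g = h)"

definition is_epi :: "('o, 'a) cat \<Rightarrow> 'a \<Rightarrow> bool" where
  "is_epi A f \<longleftrightarrow> f \<in> Arr A \<and>
     (\<forall>x. \<forall>g \<in> Hom A (Cod A f) x. \<forall>h \<in> Hom A (Cod A f) x.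
        g \<cdot>\<^bsub>A\<^esub> f = h \<cdot>\<^bsub>A\<^esub> f \<longrightarrow> g = h)"

definition zero_object :: "('o, 'a) cat \<Rightarrow> 'o \<Rightarrow> bool" where
  "zero_object A z \<longleftrightarrow> z \<in> Obj A \<and>
     (\<forall>x \<in> Obj A. (\<exists>!f. f \<in> Hom A x z) \<and> (\<exists>!f. f \<in> Hom A z x))"

definition zero_arrow :: "('o, 'a) cat \<Rightarrow> 'a \<Rightarrow> bool" where
  "zero_arrow A f \<longleftrightarrow> f \<in> Arr A \<and>
     (\<exists>z. zero_object A z \<and> (\<exists>u \<in> Hom A (Dom A f) z. \<exists>v \<in> Hom A z (Cod A f). f = v \<cdot>\<^bsub>A\<^esub> u))"

definition is_kernel :: "('o, 'a) cat \<Rightarrow> 'a \<Rightarrow> 'a \<Rightarrow> bool" where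
  "is_kernel A k f \<longleftrightarrow> k \<in> Arr A \<and> f \<in> Arr A \<and> Cod A k = Dom A f \<and> zero_arrow A (f \<cdot>\<^bsub>A\<^esub> k) \<and>
     (\<forall>x. \<forall>h \<in> Hom A x (Dom A f). zero_arrow A (f \<cdot>\<^bsub>A\<^esub> h) \<longrightarrow>
        (\<exists>!u. u \<in> Hom A x (Dom A k) \<and> k \<cdot>\<^bsub>A\<^esub> u = h))"

definition is_cokernel :: "('o, 'a) cat \<Rightarrow> 'a \<Rightarrow> 'a \<Rightarrow> bool" where
  "is_cokernel A c f \<longleftrightarrow> c \<in> Arr A \<and> f \<in> Arr A \<and> Dom A c = Cod A f \<and> zero_arrow A (c \<cdot>\<^bsub>A\<^esub> f) \<and>
     (\<forall>x. \<forall>h \<in> Hom A (Cod A f) x. zero_arrow A (h \<cdot>\<^bsub>A\<^esub> f) \<longrightarrow>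
        (\<exists>!u. u \<in> Hom A (Cod A c) x \<and> u \<cdot>\<^bsub>A\<^esub> c = h))"

text \<open>\<open>short_exact A i p\<close>: the sequence \<open>0 \<rightarrow> Dom i \<rightarrow> Cod i = Dom p \<rightarrow> Cod p \<rightarrow> 0\<close> is short exact.\<close>

definition short_exact :: "('o, 'a) cat \<Rightarrow> 'a \<Rightarrow> 'a \<Rightarrow> bool" where
  "short_exact A i p \<longleftrightarrow> is_kernel A i p \<and> is_cokernel A p i"

definition splits :: "('o, 'a) cat \<Rightarrow> 'a \<Rightarrow> 'a \<Rightarrow> bool" where
  "splits A i p \<longleftrightarrow>
     (\<exists>r \<in> Hom A (Cod A i) (Dom A i). r \<cdot>\<^bsub>A\<^esub> i = Ident A (Dom A i)) \<and>
     (\<exists>s \<in> Hom A (Cod A p) (Dom A p). p \<cdot>\<^bsub>A\<^esub> s = Ident A (Cod A p))"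


section \<open>Abelian categories\<close>

definition preadditive ::
  "('o, 'a) cat \<Rightarrow> ('a \<Rightarrow> 'a \<Rightarrow> 'a) \<Rightarrow> ('o \<Rightarrow> 'o \<Rightarrow> 'a) \<Rightarrow> bool" where
  "preadditive A add zero \<longleftrightarrow> category A \<and>
     (\<forall>x \<in> Obj A. \<forall>y \<in> Obj A.
        comm_group \<lparr>carrier = Hom A x y, monoid.mult = add, one = zero x y\<rparr>) \<and>
     (\<forall>x y z. \<forall>f \<in> Hom A x y. \<forall>f' \<in> Hom A x y. \<forall>g \<in> Hom A y z. \<forall>g' \<in> Hom A y z.
        g \<cdot>\<^bsub>A\<^esub> add f f' = add (g \<cdot>\<^bsub>A\<^esub> f) (g \<cdot>\<^bsub>A\<^esub> f') \<and>
        add g g' \<cdot>\<^bsub>A\<^esub> f = add (g \<cdot>\<^bsub>A\<^esub> f) (g' \<cdot>\<^bsub>A\<^esub> f))"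

definition has_biproducts ::
  "('o, 'a) cat \<Rightarrow> ('a \<Rightarrow> 'a \<Rightarrow> 'a) \<Rightarrow> ('o \<Rightarrow> 'o \<Rightarrow> 'a) \<Rightarrow> bool" where
  "has_biproducts A add zero \<longleftrightarrow> (\<forall>x \<in> Obj A. \<forall>y \<in> Obj A. \<exists>b \<in> Obj A.
     \<exists>i \<in> Hom A x b. \<exists>j \<in> Hom A y b. \<exists>p \<in> Hom A b x. \<exists>q \<in> Hom A b y.
       p \<cdot>\<^bsub>A\<^esub> i = Ident A x \<and> q \<cdot>\<^bsub>A\<^esub> j = Ident A y \<and>
       q \<cdot>\<^bsub>A\<^esub> i = zero x y \<and> p \<cdot>\<^bsub>A\<^esub> j = zero y x \<and>
       add (i \<cdot>\<^bsub>A\<^esub> p) (j \<cdot>\<^bsub>A\<^esub> q) = Ident A b)"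

definition additive_category :: "('o, 'a) cat \<Rightarrow> bool" where
  "additive_category A \<longleftrightarrow>
     (\<exists>add zero. preadditive A add zero \<and> has_biproducts A add zero) \<and> (\<exists>z. zero_object A z)"

definition abelian_category :: "('o, 'a) cat \<Rightarrow> bool" where
  "abelian_category A \<longleftrightarrow> additive_category A \<and>
     (\<forall>f \<in> Arr A. (\<exists>k. is_kernel A k f) \<and> (\<exists>c. is_cokernel A c f)) \<and>
     (\<forall>f. is_mono A f \<longrightarrow> (\<exists>g. is_kernel A f g)) \<and>
     (\<forall>f. is_epi A f \<longrightarrow> (\<exists>g. is_cokernel A f g))"


section \<open>Functors, natural transformations, adjunctions and monads\<close>

record ('o1, 'a1, 'o2, 'a2) fun_data =
  ob :: "'o1 \<Rightarrow> 'o2"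
  ar :: "'a1 \<Rightarrow> 'a2"

definition comp_fun ::
  "('o2, 'a2, 'o3, 'a3) fun_data \<Rightarrow> ('o1, 'a1, 'o2, 'a2) fun_data \<Rightarrow> ('o1, 'a1, 'o3, 'a3) fun_data"
  (infixl \<open>\<circ>\<^sub>F\<close> 75) where
  "G \<circ>\<^sub>F F = \<lparr>ob = ob G \<circ> ob F, ar = ar G \<circ> ar F\<rparr>"

text \<open>\<open>id_fun\<close> also serves as the inclusion of a full subcategory.\<close>

definition id_fun :: "('o, 'a, 'o, 'a) fun_data" where
  "id_fun = \<lparr>ob = id, ar = id\<rparr>"

definition fun_eq ::
  "('o1, 'a1) cat \<Rightarrow> ('o1, 'a1, 'o2, 'a2) fun_data \<Rightarrow> ('o1, 'a1, 'o2, 'a2) fun_data \<Rightarrow> bool" where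
  "fun_eq A F G \<longleftrightarrow> (\<forall>x \<in> Obj A. ob F x = ob G x) \<and> (\<forall>f \<in> Arr A. ar F f = ar G f)"

locale cfunctor = A: category A + B: category B
  for A :: "('o1, 'a1) cat" and B :: "('o2, 'a2) cat" +
  fixes F :: "('o1, 'a1, 'o2, 'a2) fun_data"
  assumes ob_closed: "x \<in> Obj A \<Longrightarrow> ob F x \<in> Obj B"
    and ar_closed: "f \<in> Hom A x y \<Longrightarrow> ar F f \<in> Hom B (ob F x) (ob F y)"
    and ar_Ident: "x \<in> Obj A \<Longrightarrow> ar F (Ident A x) = Ident B (ob F x)"
    and ar_Comp: "f \<in> Hom A x y \<Longrightarrow> g \<in> Hom A y z \<Longrightarrow> ar F (g \<cdot>\<^bsub>A\<^esub> f) = ar F g \<cdot>\<^bsub>B\<^esub> ar F f"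

definition exact_functor ::
  "('o1, 'a1) cat \<Rightarrow> ('o2, 'a2) cat \<Rightarrow> ('o1, 'a1, 'o2, 'a2) fun_data \<Rightarrow> bool" where
  "exact_functor A B F \<longleftrightarrow> cfunctor A B F \<and>
     (\<forall>i p. short_exact A i p \<longrightarrow> short_exact B (ar F i) (ar F p))"

locale nat_trans = F: cfunctor A B F + G: cfunctor A B G
  for A :: "('o1, 'a1) cat" and B :: "('o2, 'a2) cat"
    and F G :: "('o1, 'a1, 'o2, 'a2) fun_data" +
  fixes \<eta> :: "'o1 \<Rightarrow> 'a2"
  assumes component: "x \<in> Obj A \<Longrightarrow> \<eta> x \<in> Hom B (ob F x) (ob G x)"
    and naturality: "f \<in> Hom A x y \<Longrightarrow> ar G f \<cdot>\<^bsub>B\<^esub> \<eta> x = \<eta> y \<cdot>\<^bsub>B\<^esub> ar F f"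

text \<open>\<open>adjunction A B F G \<eta> \<delta>\<close>: \<open>F\<close> is left adjoint to \<open>G\<close> with unit \<open>\<eta>\<close> and counit \<open>\<delta>\<close>.\<close>

locale adjunction = unit: nat_trans A A id_fun "G \<circ>\<^sub>F F" \<eta> + counit: nat_trans B B "F \<circ>\<^sub>F G" id_fun \<delta>
    + F: cfunctor A B F + G: cfunctor B A G
  for A :: "('o1, 'a1) cat" and B :: "('o2, 'a2) cat"
    and F :: "('o1, 'a1, 'o2, 'a2) fun_data" and G :: "('o2, 'a2, 'o1, 'a1) fun_data"
    and \<eta> :: "'o1 \<Rightarrow> 'a1" and \<delta> :: "'o2 \<Rightarrow> 'a2" +
  assumes triangle_left: "x \<in> Obj A \<Longrightarrow> \<delta> (ob F x) \<cdot>\<^bsub>B\<^esub> ar F (\<eta> x) = Ident B (ob F x)"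
    and triangle_right: "y \<in> Obj B \<Longrightarrow> ar G (\<delta> y) \<cdot>\<^bsub>A\<^esub> \<eta> (ob G y) = Ident A (ob G y)"

record ('o, 'a) monad_data =
  endo :: "('o, 'a, 'o, 'a) fun_data"
  munit :: "'o \<Rightarrow> 'a"
  mmult :: "'o \<Rightarrow> 'a"

locale monad = unit: nat_trans A A id_fun "endo T" "munit T"
    + mult: nat_trans A A "endo T \<circ>\<^sub>F endo T" "endo T" "mmult T"
  for A :: "('o, 'a) cat" and T :: "('o, 'a) monad_data" +
  assumes mult_unit: "x \<in> Obj A \<Longrightarrow> mmult T x \<cdot>\<^bsub>A\<^esub> munit T (ob (endo T) x) = Ident A (ob (endo T) x)"
    and mult_endo_unit: "x \<in> Obj A \<Longrightarrow>
      mmult T x \<cdot>\<^bsub>A\<^esub> ar (endo T) (munit T x) = Ident A (ob (endo T) x)"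
    and mult_mult: "x \<in> Obj A \<Longrightarrow>
      mmult T x \<cdot>\<^bsub>A\<^esub> mmult T (ob (endo T) x) = mmult T x \<cdot>\<^bsub>A\<^esub> ar (endo T) (mmult T x)"

definition equivalent_monads ::
  "('o, 'a) cat \<Rightarrow> ('o, 'a) monad_data \<Rightarrow> ('o, 'a) monad_data \<Rightarrow> bool" where
  "equivalent_monads A T T' \<longleftrightarrow> monad A T \<and> monad A T' \<and>
     (\<exists>\<theta>. nat_trans A A (endo T) (endo T') \<theta> \<and>
        (\<forall>x \<in> Obj A. is_iso A (\<theta> x) \<and>
           \<theta> x \<cdot>\<^bsub>A\<^esub> munit T x = munit T' x \<and>
           \<theta> x \<cdot>\<^bsub>A\<^esub> mmult T x
             = mmult T' x \<cdot>\<^bsub>A\<^esub> (ar (endo T') (\<theta> x) \<cdot>\<^bsub>A\<^esub> \<theta> (ob (endo T) x))))"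


section \<open>Thick subcategories and Serre quotients\<close>

text \<open>A full subcategory of the category \<open>A\<close> is given by its set \<open>C\<close> of objects.\<close>

definition thick :: "('o, 'a) cat \<Rightarrow> 'o set \<Rightarrow> bool" where
  "thick A C \<longleftrightarrow> C \<subseteq> Obj A \<and> C \<noteq> {} \<and>
     (\<forall>i p. short_exact A i p \<longrightarrow> (Cod A i \<in> C \<longleftrightarrow> Dom A i \<in> C \<and> Cod A p \<in> C))"

text \<open>
  The index set of the direct limit. \<open>sub_mod_in A C i\<close>: \<open>i\<close> represents a subobject \<open>M' \<le> M\<close> with
  \<open>M / M'\<close> in \<open>C\<close>. \<open>quot_by_in A C p\<close>: \<open>p\<close> represents the projection \<open>N \<rightarrow> N / N'\<close> for a subobject
  \<open>N'\<close> of \<open>N\<close> lying in \<open>C\<close>.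
\<close>

definition sub_mod_in :: "('o, 'a) cat \<Rightarrow> 'o set \<Rightarrow> 'a \<Rightarrow> bool" where
  "sub_mod_in A C i \<longleftrightarrow> (\<exists>q. short_exact A i q \<and> Cod A q \<in> C)"

definition quot_by_in :: "('o, 'a) cat \<Rightarrow> 'o set \<Rightarrow> 'a \<Rightarrow> bool" where
  "quot_by_in A C p \<longleftrightarrow> (\<exists>n. short_exact A n p \<and> Dom A n \<in> C)"

text \<open>
  \<open>(i, f, p) \<in> reps A C M N\<close>: \<open>f\<close> is an element of the term \<open>Hom(M', N / N')\<close> of the direct system,
  where \<open>i : M' \<rightarrow> M\<close> and \<open>p : N \<rightarrow> N / N'\<close>.
\<close>

definition reps :: "('o, 'a) cat \<Rightarrow> 'o set \<Rightarrow> 'o \<Rightarrow> 'o \<Rightarrow> ('a \<times> 'a \<times> 'a) set" where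
  "reps A C M N = {(i, f, p). sub_mod_in A C i \<and> Cod A i = M \<and> quot_by_in A C p \<and> Dom A p = N \<and>
     f \<in> Hom A (Dom A i) (Cod A p)}"

text \<open>
  \<open>stage_map A C (i, f, p) (k, h, r)\<close>: \<open>(k, h, r)\<close> is the image of \<open>(i, f, p)\<close> under the transition
  map of the direct system to a later index. Two representatives agree in the (filtered) direct
  limit iff they have a common image at some later index.
\<close>

definition stage_map :: "('o, 'a) cat \<Rightarrow> 'o set \<Rightarrow> 'a \<times> 'a \<times> 'a \<Rightarrow> 'a \<times> 'a \<times> 'a \<Rightarrow> bool" where
  "stage_map A C = (\<lambda>(i, f, p) (k, h, r). sub_mod_in A C k \<and> quot_by_in A C r \<and>
     (\<exists>a \<in> Hom A (Dom A k) (Dom A i). \<exists>b \<in> Hom A (Cod A p) (Cod A r).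
        k = i \<cdot>\<^bsub>A\<^esub> a \<and> r = b \<cdot>\<^bsub>A\<^esub> p \<and> h = b \<cdot>\<^bsub>A\<^esub> f \<cdot>\<^bsub>A\<^esub> a))"

definition rep_equiv :: "('o, 'a) cat \<Rightarrow> 'o set \<Rightarrow> 'a \<times> 'a \<times> 'a \<Rightarrow> 'a \<times> 'a \<times> 'a \<Rightarrow> bool" where
  "rep_equiv A C x y \<longleftrightarrow> (\<exists>z. stage_map A C x z \<and> stage_map A C y z)"

definition lim_class ::
  "('o, 'a) cat \<Rightarrow> 'o set \<Rightarrow> 'o \<Rightarrow> 'o \<Rightarrow> 'a \<times> 'a \<times> 'a \<Rightarrow> ('a \<times> 'a \<times> 'a) set" where
  "lim_class A C M N x = {y \<in> reps A C M N. rep_equiv A C x y}"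

text \<open>
  Gabriel's composition. Let \<open>f : M' \<rightarrow> N / N'\<close> and \<open>g : N'' \<rightarrow> P / P'\<close> be representatives, with
  \<open>p : N \<rightarrow> N / N'\<close> and \<open>j : N'' \<rightarrow> N\<close>. The image \<open>I\<close> of \<open>p \<cdot> j = m \<cdot> e\<close> is
  \<open>(N'' + N') / N' \<cong> N'' / (N'' \<inter> N')\<close>. After restricting \<open>f\<close> along \<open>a\<close> to a smaller subobject of \<open>M\<close>
  (namely \<open>f\<^sup>-\<^sup>1 I\<close> or below) it factors through \<open>I\<close> as \<open>u\<close>; after projecting \<open>g\<close> along \<open>b\<close> to a
  smaller quotient of \<open>P\<close> (killing \<open>g(N'' \<inter> N')\<close>) it factors through \<open>I\<close> as \<open>w\<close>. The composite is
  represented by \<open>w \<cdot> u\<close>.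
\<close>

definition rep_comp ::
  "('o, 'a) cat \<Rightarrow> 'o set \<Rightarrow> 'a \<times> 'a \<times> 'a \<Rightarrow> 'a \<times> 'a \<times> 'a \<Rightarrow> 'a \<times> 'a \<times> 'a \<Rightarrow> bool" where
  "rep_comp A C = (\<lambda>(j, g, q) (i, f, p) (k, h, r). sub_mod_in A C k \<and> quot_by_in A C r \<and>
     (\<exists>a \<in> Hom A (Dom A k) (Dom A i). \<exists>b \<in> Hom A (Cod A q) (Cod A r).
      \<exists>I. \<exists>e \<in> Hom A (Dom A j) I. \<exists>m \<in> Hom A I (Cod A p).
      \<exists>u \<in> Hom A (Dom A k) I. \<exists>w \<in> Hom A I (Cod A r).
        k = i \<cdot>\<^bsub>A\<^esub> a \<and> r = b \<cdot>\<^bsub>A\<^esub> q \<and>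
        is_epi A e \<and> is_mono A m \<and> p \<cdot>\<^bsub>A\<^esub> j = m \<cdot>\<^bsub>A\<^esub> e \<and>
        f \<cdot>\<^bsub>A\<^esub> a = m \<cdot>\<^bsub>A\<^esub> u \<and> b \<cdot>\<^bsub>A\<^esub> g = w \<cdot>\<^bsub>A\<^esub> e \<and> h = w \<cdot>\<^bsub>A\<^esub> u))"

text \<open>
  An arrow of \<open>A / C\<close> is a triple \<open>(M, N, \<phi>)\<close> of its domain, its codomain and an element \<open>\<phi>\<close> of the
  direct limit, i.e. an equivalence class of representatives.
\<close>

definition serre_quotient ::
  "('o, 'a) cat \<Rightarrow> 'o set \<Rightarrow> ('o, 'o \<times> 'o \<times> ('a \<times> 'a \<times> 'a) set) cat" where
  "serre_quotient A C = \<lparr>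
     Obj = Obj A,
     Arr = {(M, N, lim_class A C M N x) |M N x. M \<in> Obj A \<and> N \<in> Obj A \<and> x \<in> reps A C M N},
     Dom = (\<lambda>(M, N, \<phi>). M),
     Cod = (\<lambda>(M, N, \<phi>). N),
     Ident = (\<lambda>M. (M, M, lim_class A C M M (Ident A M, Ident A M, Ident A M))),
     Comp = (\<lambda>(N', P, \<psi>) (M, N, \<phi>).
       (M, P, \<Union>{lim_class A C M P z |x y z. x \<in> \<phi> \<and> y \<in> \<psi> \<and> rep_comp A C y x z}))\<rparr>"

definition quotient_functor ::
  "('o, 'a) cat \<Rightarrow> 'o set \<Rightarrow> ('o, 'a, 'o, 'o \<times> 'o \<times> ('a \<times> 'a \<times> 'a) set) fun_data" where
  "quotient_functor A C = \<lparr>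
     ob = id,
     ar = (\<lambda>f. (Dom A f, Cod A f,
       lim_class A C (Dom A f) (Cod A f) (Ident A (Dom A f), f, Ident A (Cod A f))))\<rparr>"

definition localizing :: "('o, 'a) cat \<Rightarrow> 'o set \<Rightarrow> bool" where
  "localizing A C \<longleftrightarrow> thick A C \<and>
     (\<exists>S \<eta> \<delta>. adjunction A (serre_quotient A C) (quotient_functor A C) S \<eta> \<delta>)"


section \<open>Gabriel monads and saturating monads\<close>

definition gabriel_monad :: "('o, 'a) cat \<Rightarrow> 'o set \<Rightarrow> ('o, 'a) monad_data \<Rightarrow> bool" where
  "gabriel_monad A C T \<longleftrightarrow>
     (\<exists>S \<eta> \<delta>. adjunction A (serre_quotient A C) (quotient_functor A C) S \<eta> \<delta> \<and>
        T = \<lparr>endo = S \<circ>\<^sub>F quotient_functor A C, munit = \<eta>,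
             mmult = (\<lambda>x. ar S (\<delta> (ob (quotient_functor A C) x)))\<rparr>)"

definition saturated :: "('o, 'a) cat \<Rightarrow> 'o set \<Rightarrow> 'o \<Rightarrow> bool" where
  "saturated A C M \<longleftrightarrow> M \<in> Obj A \<and>
     (\<forall>i. is_mono A i \<and> Cod A i = M \<and> Dom A i \<in> C \<longrightarrow> zero_object A (Dom A i)) \<and>
     (\<forall>i p. short_exact A i p \<and> Dom A i = M \<and> Cod A p \<in> C \<longrightarrow> splits A i p)"

definition Sat :: "('o, 'a) cat \<Rightarrow> 'o set \<Rightarrow> ('o, 'a) cat" where
  "Sat A C = full_subcategory A {M. saturated A C M}"

text \<open>
  The corestriction of \<open>W\<close> to the full subcategory \<open>Sat A C\<close> has the same underlying data as \<open>W\<close>;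
  its exactness refers to short exact sequences of \<open>Sat A C\<close>, i.e. to kernels and cokernels formed
  there and not in \<open>A\<close>.
\<close>

definition saturating_endofunctor ::
  "('o, 'a) cat \<Rightarrow> 'o set \<Rightarrow> ('o, 'a, 'o, 'a) fun_data \<Rightarrow> ('o \<Rightarrow> 'a) \<Rightarrow> bool" where
  "saturating_endofunctor A C W \<eta> \<longleftrightarrow>
     cfunctor A A W \<and> nat_trans A A id_fun W \<eta> \<and>
     (\<forall>M \<in> C. zero_object A (ob W M)) \<and>
     (\<forall>M \<in> Obj A. saturated A C (ob W M)) \<and>
     exact_functor A (Sat A C) W \<and>
     (\<forall>M \<in> Obj A. \<eta> (ob W M) = ar W (\<eta> M)) \<and>
     (\<forall>M. saturated A C M \<longrightarrow> is_iso A (\<eta> M))"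

text \<open>\<open>H : A / C \<rightarrow> Sat A C\<close> with \<open>W = H \<circ> Q\<close>; the colift of \<open>W\<close> is \<open>H\<close> followed by the inclusion.\<close>

definition factors_through_quotient ::
  "('o, 'a) cat \<Rightarrow> 'o set \<Rightarrow> ('o, 'a, 'o, 'a) fun_data \<Rightarrow>
   ('o, 'o \<times> 'o \<times> ('a \<times> 'a \<times> 'a) set, 'o, 'a) fun_data \<Rightarrow> bool" where
  "factors_through_quotient A C W H \<longleftrightarrow>
     cfunctor (serre_quotient A C) (Sat A C) H \<and> fun_eq A W (H \<circ>\<^sub>F quotient_functor A C)"

definition is_colift ::
  "('o, 'a) cat \<Rightarrow> 'o set \<Rightarrow> ('o, 'a, 'o, 'a) fun_data \<Rightarrow>
   ('o, 'o \<times> 'o \<times> ('a \<times> 'a \<times> 'a) set, 'o, 'a) fun_data \<Rightarrow> bool" where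
  "is_colift A C W H' \<longleftrightarrow> (\<exists>H. factors_through_quotient A C W H \<and> H' = id_fun \<circ>\<^sub>F H)"

definition saturating_monad :: "('o, 'a) cat \<Rightarrow> 'o set \<Rightarrow> ('o, 'a) monad_data \<Rightarrow> bool" where
  "saturating_monad A C T \<longleftrightarrow>
     (\<exists>W \<eta> H \<delta>. saturating_endofunctor A C W \<eta> \<and> is_colift A C W H \<and>
        adjunction A (serre_quotient A C) (quotient_functor A C) H \<eta> \<delta> \<and>
        T = \<lparr>endo = W, munit = \<eta>, mmult = (\<lambda>x. ar H (\<delta> (ob (quotient_functor A C) x)))\<rparr>)"

end

theory Submission
  imports Defs
begin

text \<open>
  A saturating monad is by definition the monad of an adjunction between \<open>Q\<close> and a colift, so up to
  values outside the carriers it already is a Gabriel monad; the work lies in the other direction.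
  Given a section functor \<open>S\<close> with unit \<open>\<eta>\<close>, all arrows \<open>Q \<eta>\<close> are invertible, because \<open>Q \<eta>\<close> is natural
  with respect to all fractions. Hence \<open>\<eta>\<close> has its kernel and cokernel in \<open>C\<close>, and the objects \<open>S y\<close> are
  local: every arrow into them extends uniquely along an arrow that \<open>Q\<close> inverts. Locality makes \<open>S y\<close>
  saturated and \<open>\<eta>\<close> invertible at saturated objects; by uniqueness of extensions it also gives
  \<open>\<eta> W = W \<eta>\<close> and shows that \<open>W = S \<circ> Q\<close> sends cokernels to cokernels among saturated objects.
  That \<open>W\<close> preserves kernels is seen by comparing \<open>ker p\<close> with \<open>ker (W p)\<close> through \<open>\<eta>\<close>.
\<close>

section \<open>Categories\<close>

text \<open>The category laws of \<open>A / C\<close> and the functoriality of \<open>Q\<close> come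
  with the adjunction, and the calculus of fractions is read off from these laws. In place of
  exactness of \<open>Q\<close>, an equation between images under \<open>Q\<close> is traced back to
  representatives that agree at a common later stage; this is what places kernels and cokernels in
  \<open>C\<close>. One obstacle is that \<open>S\<close> is not known to be fully faithful at the
  outset: the triangle identity makes \<open>\<delta> x\<close> only a left inverse of
  \<open>Q (\<eta> x)\<close>, and naturality at the arrow \<open>\<delta> x\<close>, which need not
  come from \<open>A\<close>, supplies the other side. Another is that exactness refers to
  \<open>Sat A C\<close>. A kernel in \<open>A\<close> between saturated objects is a kernel there,
  so kernels can be computed in \<open>A\<close>. In contrast, \<open>W p\<close> need not be epi in
  \<open>A\<close> when \<open>p\<close> is, so cokernels are tested directly against saturated
  objects.\<close>

lemma Hom_iff: "f \<in> Hom A x y \<longleftrightarrow> f \<in> Arr A \<and> Dom A f = x \<and> Cod A f = y"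
  by (simp add: Hom_def)

context category
begin

lemma Comp_arr [simp]:
    "f \<in> Arr A \<Longrightarrow> g \<in> Arr A \<Longrightarrow> Cod A f = Dom A g \<Longrightarrow> g \<cdot> f \<in> Arr A"
  and Dom_Comp [simp]:
    "f \<in> Arr A \<Longrightarrow> g \<in> Arr A \<Longrightarrow> Cod A f = Dom A g \<Longrightarrow> Dom A (g \<cdot> f) = Dom A f"
  and Cod_Comp [simp]:
    "f \<in> Arr A \<Longrightarrow> g \<in> Arr A \<Longrightarrow> Cod A f = Dom A g \<Longrightarrow> Cod A (g \<cdot> f) = Cod A g"
  using Comp_closed[of f "Dom A f" "Dom A g" g "Cod A g"] by (simp_all add: Hom_iff)

lemma Ident_arr [simp]: "x \<in> Obj A \<Longrightarrow> Ident A x \<in> Arr A"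
  and Dom_Ident [simp]: "x \<in> Obj A \<Longrightarrow> Dom A (Ident A x) = x"
  and Cod_Ident [simp]: "x \<in> Obj A \<Longrightarrow> Cod A (Ident A x) = x"
  using Ident_closed by (simp_all add: Hom_iff)

lemma Comp_Ident_arr [simp]: "f \<in> Arr A \<Longrightarrow> Dom A f = x \<Longrightarrow> f \<cdot> Ident A x = f"
  and Ident_Comp_arr [simp]: "f \<in> Arr A \<Longrightarrow> Cod A f = x \<Longrightarrow> Ident A x \<cdot> f = f"
  using Comp_Ident Ident_Comp by (auto simp: Hom_iff)

lemma Comp_assoc_arr [simp]:
  "f \<in> Arr A \<Longrightarrow> g \<in> Arr A \<Longrightarrow> h \<in> Arr A \<Longrightarrow> Cod A f = Dom A g \<Longrightarrow> Cod A g = Dom A h \<Longrightarrow>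
    (h \<cdot> g) \<cdot> f = h \<cdot> (g \<cdot> f)"
  using Comp_assoc by (auto simp: Hom_iff)

declare Dom_closed [simp] Cod_closed [simp]

lemma Comp_eq_assoc:
  assumes "g \<cdot> f = k"
    and "f \<in> Arr A" "g \<in> Arr A" "h \<in> Arr A" "Cod A h = Dom A f" "Cod A f = Dom A g"
  shows "g \<cdot> (f \<cdot> h) = k \<cdot> h"
  using assms by (metis Comp_assoc_arr)

text \<open>\<open>is_mono\<close> speaks of parallel arrows; equality of the composites already
  forces equal domains, so callers only have to check codomains.\<close>

lemma is_mono_cancel:
  assumes "is_mono A m" "m \<cdot> g = m \<cdot> h"
    and "g \<in> Arr A" "h \<in> Arr A" "Cod A g = Dom A m" "Cod A h = Dom A m"
  shows "g = h"
proof -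
  have "Dom A g = Dom A h"
    using assms by (metis Dom_Comp is_mono_def)
  then show ?thesis
    using assms by (auto simp: is_mono_def Hom_iff)
qed

lemma is_epi_cancel:
  assumes "is_epi A e" "g \<cdot> e = h \<cdot> e"
    and "g \<in> Arr A" "h \<in> Arr A" "Dom A g = Cod A e" "Dom A h = Cod A e"
  shows "g = h"
proof -
  have "Cod A g = Cod A h"
    using assms by (metis Cod_Comp is_epi_def)
  then show ?thesis
    using assms by (auto simp: is_epi_def Hom_iff)
qed

lemma is_mono_arr: "is_mono A m \<Longrightarrow> m \<in> Arr A"
  by (simp add: is_mono_def)

lemma is_epi_arr: "is_epi A e \<Longrightarrow> e \<in> Arr A"
  by (simp add: is_epi_def)

lemma is_monoI:
  assumes "m \<in> Arr A"
    and "\<And>g h. g \<in> Arr A \<Longrightarrow> h \<in> Arr A \<Longrightarrow> Dom A g = Dom A h \<Longrightarrow> Cod A g = Dom A m \<Longrightarrow>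
      Cod A h = Dom A m \<Longrightarrow> m \<cdot> g = m \<cdot> h \<Longrightarrow> g = h"
  shows "is_mono A m"
  using assms by (auto simp: is_mono_def Hom_iff)

lemma is_epiI:
  assumes "e \<in> Arr A"
    and "\<And>g h. g \<in> Arr A \<Longrightarrow> h \<in> Arr A \<Longrightarrow> Cod A g = Cod A h \<Longrightarrow> Dom A g = Cod A e \<Longrightarrow>
      Dom A h = Cod A e \<Longrightarrow> g \<cdot> e = h \<cdot> e \<Longrightarrow> g = h"
  shows "is_epi A e"
  using assms by (auto simp: is_epi_def Hom_iff)

lemma is_mono_Comp:
  assumes "is_mono A m" "is_mono A n" "Cod A n = Dom A m"
  shows "is_mono A (m \<cdot> n)"
proof (rule is_monoI)
  show "m \<cdot> n \<in> Arr A"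
    using assms by (simp add: is_mono_arr)
next
  fix g h
  assume gh: "g \<in> Arr A" "h \<in> Arr A" "Dom A g = Dom A h" "Cod A g = Dom A (m \<cdot> n)"
    "Cod A h = Dom A (m \<cdot> n)" "(m \<cdot> n) \<cdot> g = (m \<cdot> n) \<cdot> h"
  have "m \<cdot> (n \<cdot> g) = m \<cdot> (n \<cdot> h)"
    using gh assms by (simp add: is_mono_arr)
  then have "n \<cdot> g = n \<cdot> h"
    using gh assms is_mono_cancel[of m "n \<cdot> g" "n \<cdot> h"] by (simp add: is_mono_arr)
  then show "g = h"
    using gh assms is_mono_cancel[of n g h] by (simp add: is_mono_arr)
qed

lemma is_mono_right:
  assumes "is_mono A (m \<cdot> n)" "m \<in> Arr A" "n \<in> Arr A" "Cod A n = Dom A m"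
  shows "is_mono A n"
proof (rule is_monoI)
  fix g h
  assume gh: "g \<in> Arr A" "h \<in> Arr A" "Dom A g = Dom A h" "Cod A g = Dom A n"
    "Cod A h = Dom A n" "n \<cdot> g = n \<cdot> h"
  then show "g = h"
    using assms is_mono_cancel[of "m \<cdot> n" g h] by simp
qed (use assms in simp)

lemma is_epi_left:
  assumes "is_epi A (g \<cdot> f)" "f \<in> Arr A" "g \<in> Arr A" "Cod A f = Dom A g"
  shows "is_epi A g"
proof (rule is_epiI)
  fix h k
  assume hk: "h \<in> Arr A" "k \<in> Arr A" "Cod A h = Cod A k" "Dom A h = Cod A g"
    "Dom A k = Cod A g" "h \<cdot> g = k \<cdot> g"
  have "h \<cdot> (g \<cdot> f) = k \<cdot> (g \<cdot> f)"
    using hk assms by (metis Comp_assoc_arr)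
  then show "h = k"
    using hk assms is_epi_cancel[of "g \<cdot> f" h k] by simp
qed (use assms in simp)

lemma is_epi_Comp:
  assumes "is_epi A e" "is_epi A d" "Cod A e = Dom A d"
  shows "is_epi A (d \<cdot> e)"
proof (rule is_epiI)
  show "d \<cdot> e \<in> Arr A"
    using assms by (simp add: is_epi_arr)
next
  fix g h
  assume gh: "g \<in> Arr A" "h \<in> Arr A" "Cod A g = Cod A h" "Dom A g = Cod A (d \<cdot> e)"
    "Dom A h = Cod A (d \<cdot> e)" "g \<cdot> (d \<cdot> e) = h \<cdot> (d \<cdot> e)"
  have "(g \<cdot> d) \<cdot> e = (h \<cdot> d) \<cdot> e"
    using gh assms by (simp add: is_epi_arr)
  then have "g \<cdot> d = h \<cdot> d"
    using gh assms is_epi_cancel[of e "g \<cdot> d" "h \<cdot> d"] by (simp add: is_epi_arr)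
  then show "g = h"
    using gh assms is_epi_cancel[of d g h] by (simp add: is_epi_arr)
qed

lemma is_monoI_retraction:
  assumes "m \<in> Arr A" "r \<in> Arr A" "Dom A r = Cod A m" "r \<cdot> m = Ident A (Dom A m)"
  shows "is_mono A m"
proof (rule is_monoI)
  fix g h
  assume gh: "g \<in> Arr A" "h \<in> Arr A" "Dom A g = Dom A h" "Cod A g = Dom A m"
    "Cod A h = Dom A m" "m \<cdot> g = m \<cdot> h"
  have "g = r \<cdot> (m \<cdot> g)"
    using gh(1-5) assms Comp_eq_assoc[OF assms(4), of g] by simp
  also have "\<dots> = r \<cdot> (m \<cdot> h)"
    using gh by simp
  also have "\<dots> = h"
    using gh(1-5) assms Comp_eq_assoc[OF assms(4), of h] by simp
  finally show "g = h" .
qed (use assms in simp)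

lemma is_isoI:
  assumes "f \<in> Arr A" "g \<in> Arr A" "Dom A g = Cod A f" "Cod A g = Dom A f"
    "g \<cdot> f = Ident A (Dom A f)" "f \<cdot> g = Ident A (Cod A f)"
  shows "is_iso A f"
  using assms by (auto simp: is_iso_def Hom_iff)

lemma is_isoE:
  assumes "is_iso A f"
  obtains g where "f \<in> Arr A" "g \<in> Arr A" "Dom A g = Cod A f" "Cod A g = Dom A f"
    "g \<cdot> f = Ident A (Dom A f)" "f \<cdot> g = Ident A (Cod A f)"
  using assms by (auto simp: is_iso_def Hom_iff)

lemma is_iso_Ident: "x \<in> Obj A \<Longrightarrow> is_iso A (Ident A x)"
  by (rule is_isoI[where g = "Ident A x"]) auto

lemma is_iso_is_mono: "is_iso A f \<Longrightarrow> is_mono A f"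
  by (erule is_isoE) (rule is_monoI_retraction)

lemma is_iso_is_epi:
  assumes "is_iso A f"
  shows "is_epi A f"
proof -
  obtain r where r: "f \<in> Arr A" "r \<in> Arr A" "Dom A r = Cod A f" "Cod A r = Dom A f"
      "f \<cdot> r = Ident A (Cod A f)"
    using assms by (rule is_isoE)
  show ?thesis
  proof (rule is_epiI)
    fix g h
    assume gh: "g \<in> Arr A" "h \<in> Arr A" "Cod A g = Cod A h" "Dom A g = Cod A f"
      "Dom A h = Cod A f" "g \<cdot> f = h \<cdot> f"
    have "g = (g \<cdot> f) \<cdot> r"
      using gh(1-5) r by simp
    also have "\<dots> = (h \<cdot> f) \<cdot> r"
      using gh by simp
    also have "\<dots> = h"
      using gh(1-5) r by simp
    finally show "g = h" .
  qed (use r in simp)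
qed

lemma is_iso_Comp:
  assumes "is_iso A f" "is_iso A g" "Cod A f = Dom A g"
  shows "is_iso A (g \<cdot> f)"
proof -
  obtain f' where f: "f \<in> Arr A" "f' \<in> Arr A" "Dom A f' = Cod A f" "Cod A f' = Dom A f"
      "f' \<cdot> f = Ident A (Dom A f)" "f \<cdot> f' = Ident A (Cod A f)"
    using assms(1) by (rule is_isoE)
  obtain g' where g: "g \<in> Arr A" "g' \<in> Arr A" "Dom A g' = Cod A g" "Cod A g' = Dom A g"
      "g' \<cdot> g = Ident A (Dom A g)" "g \<cdot> g' = Ident A (Cod A g)"
    using assms(2) by (rule is_isoE)
  show ?thesis
  proof (rule is_isoI[where g = "f' \<cdot> g'"])
    have "g' \<cdot> (g \<cdot> f) = f"
      using f g assms by (simp flip: Comp_assoc_arr)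
    then show "f' \<cdot> g' \<cdot> (g \<cdot> f) = Ident A (Dom A (g \<cdot> f))"
      using f g assms by simp
    have "f \<cdot> (f' \<cdot> g') = g'"
      using f g assms by (simp flip: Comp_assoc_arr)
    then show "g \<cdot> f \<cdot> (f' \<cdot> g') = Ident A (Cod A (g \<cdot> f))"
      using f g assms by simp
  qed (use f g assms in simp_all)
qed

end

lemma full_subcategory_simps [simp]:
  "Obj (full_subcategory A S) = S"
  "Dom (full_subcategory A S) = Dom A"
  "Cod (full_subcategory A S) = Cod A"
  "Ident (full_subcategory A S) = Ident A"
  "Comp (full_subcategory A S) = Comp A"
  "f \<in> Arr (full_subcategory A S) \<longleftrightarrow> f \<in> Arr A \<and> Dom A f \<in> S \<and> Cod A f \<in> S"
  by (simp_all add: full_subcategory_def)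

lemma (in category) category_full_subcategory:
  assumes "S \<subseteq> Obj A"
  shows "category (full_subcategory A S)"
  by unfold_locales (use assms in \<open>auto simp: Hom_iff subset_iff\<close>)

context cfunctor
begin

lemma ar_arr [simp]: "f \<in> Arr A \<Longrightarrow> ar F f \<in> Arr B"
  and Dom_ar [simp]: "f \<in> Arr A \<Longrightarrow> Dom B (ar F f) = ob F (Dom A f)"
  and Cod_ar [simp]: "f \<in> Arr A \<Longrightarrow> Cod B (ar F f) = ob F (Cod A f)"
  using ar_closed by (auto simp: Hom_iff)

lemma ar_Comp_arr:
  "f \<in> Arr A \<Longrightarrow> g \<in> Arr A \<Longrightarrow> Cod A f = Dom A g \<Longrightarrow> ar F (g \<cdot>\<^bsub>A\<^esub> f) = ar F g \<cdot>\<^bsub>B\<^esub> ar F f"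
  using ar_Comp by (auto simp: Hom_iff)

lemma is_iso_ar:
  assumes "is_iso A f"
  shows "is_iso B (ar F f)"
proof -
  obtain g where g: "f \<in> Arr A" "g \<in> Arr A" "Dom A g = Cod A f" "Cod A g = Dom A f"
    "g \<cdot>\<^bsub>A\<^esub> f = Ident A (Dom A f)" "f \<cdot>\<^bsub>A\<^esub> g = Ident A (Cod A f)"
    using assms by (rule A.is_isoE)
  show ?thesis
    using g by (intro B.is_isoI[where g = "ar F g"]) (auto simp: ar_Ident simp flip: ar_Comp_arr)
qed

end

section \<open>Abelian categories\<close>

text \<open>\<open>abelian_category\<close> asserts only that some additive structure exists. The
  locale fixes a witness, so that zero arrows and differences of arrows can be named.\<close>

locale abelian = category A
  for A :: "('o, 'a) cat" (structure) +
  fixes add :: "'a \<Rightarrow> 'a \<Rightarrow> 'a" and zero :: "'o \<Rightarrow> 'o \<Rightarrow> 'a"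
  assumes preadditive: "preadditive A add zero"
    and zero_object_ex: "\<exists>z. zero_object A z"
    and kernel_ex: "f \<in> Arr A \<Longrightarrow> \<exists>k. is_kernel A k f"
    and cokernel_ex: "f \<in> Arr A \<Longrightarrow> \<exists>c. is_cokernel A c f"
    and mono_kernel: "is_mono A f \<Longrightarrow> \<exists>g. is_kernel A f g"
    and epi_cokernel: "is_epi A f \<Longrightarrow> \<exists>g. is_cokernel A f g"

lemma abelian_category_imp_abelian:
  assumes "abelian_category A"
  shows "\<exists>add zero. abelian A add zero"
  using assms
  unfolding abelian_category_def additive_category_def abelian_def abelian_axioms_def preadditive_def
  by blast

context abelian
begin

lemma Hom_comm_group:
  "x \<in> Obj A \<Longrightarrow> y \<in> Obj A \<Longrightarrow> comm_group \<lparr>carrier = Hom A x y, monoid.mult = add, one = zero x y\<rparr>"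
  using preadditive by (simp add: preadditive_def)

lemma zero_arr [simp]: "x \<in> Obj A \<Longrightarrow> y \<in> Obj A \<Longrightarrow> zero x y \<in> Arr A"
  and Dom_zero [simp]: "x \<in> Obj A \<Longrightarrow> y \<in> Obj A \<Longrightarrow> Dom A (zero x y) = x"
  and Cod_zero [simp]: "x \<in> Obj A \<Longrightarrow> y \<in> Obj A \<Longrightarrow> Cod A (zero x y) = y"
proof -
  assume "x \<in> Obj A" "y \<in> Obj A"
  then interpret G: comm_group "\<lparr>carrier = Hom A x y, monoid.mult = add, one = zero x y\<rparr>"
    by (rule Hom_comm_group)
  show "zero x y \<in> Arr A" "Dom A (zero x y) = x" "Cod A (zero x y) = y"
    using G.one_closed by (simp_all add: Hom_iff)
qed

lemma add_zero_left: "f \<in> Hom A x y \<Longrightarrow> add (zero x y) f = f"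
  and add_right_cancel: "f \<in> Hom A x y \<Longrightarrow> g \<in> Hom A x y \<Longrightarrow> h \<in> Hom A x y \<Longrightarrow>
    add f h = add g h \<longleftrightarrow> f = g"
  and add_commute: "f \<in> Hom A x y \<Longrightarrow> g \<in> Hom A x y \<Longrightarrow> add f g = add g f"
  and diff_ex: "f \<in> Hom A x y \<Longrightarrow> g \<in> Hom A x y \<Longrightarrow> \<exists>d \<in> Hom A x y. add d g = f"
proof -
  assume f: "f \<in> Hom A x y"
  then have "x \<in> Obj A" "y \<in> Obj A"
    by (auto simp: Hom_iff)
  then interpret G: comm_group "\<lparr>carrier = Hom A x y, monoid.mult = add, one = zero x y\<rparr>"
    by (rule Hom_comm_group)
  show "add (zero x y) f = f"
    using G.l_one f by simp
  show "add f h = add g h \<longleftrightarrow> f = g" if "g \<in> Hom A x y" "h \<in> Hom A x y"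
    using G.right_cancel[of h f g] f that by simp
  show "add f g = add g f" if "g \<in> Hom A x y"
    using G.m_comm f that by simp
  show "\<exists>d \<in> Hom A x y. add d g = f" if "g \<in> Hom A x y"
  proof -
    let ?G = "\<lparr>carrier = Hom A x y, monoid.mult = add, one = zero x y\<rparr>"
    show ?thesis
      using f that G.inv_closed[of g] G.m_closed[of f "inv\<^bsub>?G\<^esub> g"] G.m_assoc[of f "inv\<^bsub>?G\<^esub> g" g]
        G.l_inv[of g] G.r_one[of f]
      by (intro bexI[of _ "add f (inv\<^bsub>?G\<^esub> g)"]) auto
  qed
qed

lemma Comp_add:
  assumes "f \<in> Hom A x y" "f' \<in> Hom A x y" "g \<in> Hom A y z"
  shows "g \<cdot> add f f' = add (g \<cdot> f) (g \<cdot> f')"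
  using preadditive assms unfolding preadditive_def by blast

lemma add_Comp:
  assumes "f \<in> Hom A x y" "g \<in> Hom A y z" "g' \<in> Hom A y z"
  shows "add g g' \<cdot> f = add (g \<cdot> f) (g' \<cdot> f)"
  using preadditive assms unfolding preadditive_def by blast

text \<open>Cancel \<open>f\<close> in \<open>f + f = 0 + f\<close>. By bilinearity a composite with
  zero is its own double, which is how such composites are recognised as zero.\<close>

lemma zero_if_idem: "f \<in> Hom A x y \<Longrightarrow> add f f = f \<Longrightarrow> f = zero x y"
  using add_right_cancel[of f x y "zero x y" f] add_zero_left[of f x y] by (auto simp: Hom_iff)

lemma Comp_zero [simp]:
  assumes "f \<in> Arr A" "x \<in> Obj A" "Dom A f = y"
  shows "f \<cdot> zero x y = zero x (Cod A f)"
proof (rule zero_if_idem)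
  have z: "zero x y \<in> Hom A x y"
    using assms by (auto simp: Hom_iff)
  show "f \<cdot> zero x y \<in> Hom A x (Cod A f)"
    using assms by (auto simp: Hom_iff)
  show "add (f \<cdot> zero x y) (f \<cdot> zero x y) = f \<cdot> zero x y"
    using Comp_add[OF z z, of f] add_zero_left[OF z] assms by (simp add: Hom_iff)
qed

lemma zero_Comp [simp]:
  assumes "f \<in> Arr A" "y \<in> Obj A" "Cod A f = x"
  shows "zero x y \<cdot> f = zero (Dom A f) y"
proof (rule zero_if_idem)
  have z: "zero x y \<in> Hom A x y"
    using assms by (auto simp: Hom_iff)
  show "zero x y \<cdot> f \<in> Hom A (Dom A f) y"
    using assms by (auto simp: Hom_iff)
  show "add (zero x y \<cdot> f) (zero x y \<cdot> f) = zero x y \<cdot> f"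
    using add_Comp[OF _ z z, of f] add_zero_left[OF z] assms by (simp add: Hom_iff)
qed

text \<open>The arrow \<open>d\<close> is \<open>f - g\<close>.\<close>

lemma differenceE:
  assumes "f \<in> Arr A" "g \<in> Arr A" "Dom A f = Dom A g" "Cod A f = Cod A g"
  obtains d where "d \<in> Arr A" "Dom A d = Dom A g" "Cod A d = Cod A g"
    "d = zero (Dom A g) (Cod A g) \<longleftrightarrow> f = g"
    "\<And>h. h \<in> Arr A \<Longrightarrow> Dom A h = Cod A g \<Longrightarrow> h \<cdot> d = zero (Dom A g) (Cod A h) \<longleftrightarrow> h \<cdot> f = h \<cdot> g"
    "\<And>h. h \<in> Arr A \<Longrightarrow> Cod A h = Dom A g \<Longrightarrow> d \<cdot> h = zero (Dom A h) (Cod A g) \<longleftrightarrow> f \<cdot> h = g \<cdot> h"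
    "\<And>h. h \<in> Arr A \<Longrightarrow> Dom A h = Cod A g \<Longrightarrow> h \<cdot> g = zero (Dom A g) (Cod A h) \<Longrightarrow> h \<cdot> d = h \<cdot> f"
proof -
  have fH: "f \<in> Hom A (Dom A g) (Cod A g)" and gH: "g \<in> Hom A (Dom A g) (Cod A g)"
    using assms by (auto simp: Hom_iff)
  obtain d where d: "d \<in> Hom A (Dom A g) (Cod A g)" "add d g = f"
    using diff_ex[OF fH gH] by blast
  show thesis
  proof (rule that[of d])
    show "d = zero (Dom A g) (Cod A g) \<longleftrightarrow> f = g"
      using d add_right_cancel[of d "Dom A g" "Cod A g" "zero (Dom A g) (Cod A g)" g] gH
        add_zero_left[OF gH] by (auto simp: Hom_iff)
  next
    fix h
    assume h: "h \<in> Arr A" "Dom A h = Cod A g"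
    then have H: "h \<cdot> d \<in> Hom A (Dom A g) (Cod A h)" "h \<cdot> g \<in> Hom A (Dom A g) (Cod A h)"
        "zero (Dom A g) (Cod A h) \<in> Hom A (Dom A g) (Cod A h)"
      using d gH by (auto simp: Hom_iff)
    have eq: "h \<cdot> f = add (h \<cdot> d) (h \<cdot> g)"
      using Comp_add[OF d(1) gH, of h "Cod A h"] h d by (simp add: Hom_iff)
    then show "h \<cdot> d = zero (Dom A g) (Cod A h) \<longleftrightarrow> h \<cdot> f = h \<cdot> g"
      using add_right_cancel[OF H(1,3,2)] add_zero_left[OF H(2)] by auto
    show "h \<cdot> d = h \<cdot> f" if "h \<cdot> g = zero (Dom A g) (Cod A h)"
      using eq that add_zero_left[OF H(1)] add_commute[OF H(1,3)] by simp
  next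
    fix h
    assume h: "h \<in> Arr A" "Cod A h = Dom A g"
    then have H: "d \<cdot> h \<in> Hom A (Dom A h) (Cod A g)" "g \<cdot> h \<in> Hom A (Dom A h) (Cod A g)"
        "zero (Dom A h) (Cod A g) \<in> Hom A (Dom A h) (Cod A g)"
      using d gH by (auto simp: Hom_iff)
    have "f \<cdot> h = add (d \<cdot> h) (g \<cdot> h)"
      using add_Comp[OF _ d(1) gH, of h "Dom A h"] h d by (simp add: Hom_iff)
    then show "d \<cdot> h = zero (Dom A h) (Cod A g) \<longleftrightarrow> f \<cdot> h = g \<cdot> h"
      using add_right_cancel[OF H(1,3,2)] add_zero_left[OF H(2)] by auto
  qed (use d in \<open>simp_all add: Hom_iff\<close>)
qed

text \<open>This turns a universal property into one equation between arrows, which can then be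
  proved by cancelling a mono or an arrow inverted by \<open>Q\<close>.\<close>

lemma zero_object_iff: "zero_object A x \<longleftrightarrow> x \<in> Obj A \<and> Ident A x = zero x x"
proof
  assume x: "zero_object A x"
  then have o: "x \<in> Obj A"
    by (simp add: zero_object_def)
  then have "\<exists>!f. f \<in> Hom A x x"
    using x by (simp add: zero_object_def)
  moreover have "Ident A x \<in> Hom A x x" "zero x x \<in> Hom A x x"
    using o by (simp_all add: Hom_iff)
  ultimately show "x \<in> Obj A \<and> Ident A x = zero x x"
    using o by blast
next
  assume x: "x \<in> Obj A \<and> Ident A x = zero x x"
  show "zero_object A x"
    unfolding zero_object_def
  proof (intro conjI ballI)
    show "x \<in> Obj A"
      using x by simp
  next
    fix y
    assume y: "y \<in> Obj A"
    show "\<exists>!f. f \<in> Hom A y x"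
    proof (rule ex1I[of _ "zero y x"])
      fix f
      assume f: "f \<in> Hom A y x"
      have "Ident A x \<cdot> f = zero x x \<cdot> f"
        using x by simp
      then show "f = zero y x"
        using f x y by (metis Hom_iff Ident_Comp_arr zero_Comp)
    qed (use x y in \<open>simp add: Hom_iff\<close>)
    show "\<exists>!f. f \<in> Hom A x y"
    proof (rule ex1I[of _ "zero x y"])
      fix f
      assume f: "f \<in> Hom A x y"
      have "f \<cdot> Ident A x = f \<cdot> zero x x"
        using x by simp
      then show "f = zero x y"
        using f x y by (metis Hom_iff Comp_Ident_arr Comp_zero)
    qed (use x y in \<open>simp add: Hom_iff\<close>)
  qed
qed

lemma zero_object_Obj: "zero_object A x \<Longrightarrow> x \<in> Obj A"
  by (simp add: zero_object_def)

lemma to_zero_object: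
  assumes "zero_object A x" "f \<in> Arr A" "Cod A f = x"
  shows "f = zero (Dom A f) x"
proof -
  have "Ident A x \<cdot> f = zero x x \<cdot> f"
    using assms(1) by (simp only: zero_object_iff)
  then show ?thesis
    using assms by (simp add: zero_object_Obj)
qed

lemma from_zero_object:
  assumes "zero_object A x" "f \<in> Arr A" "Dom A f = x"
  shows "f = zero x (Cod A f)"
proof -
  have "f \<cdot> Ident A x = f \<cdot> zero x x"
    using assms(1) by (simp only: zero_object_iff)
  then show ?thesis
    using assms by (simp add: zero_object_Obj)
qed

text \<open>The zero arrows in the definition of kernels factor through a zero object; identifying
  them with the neutral elements of the Hom groups makes kernels and cokernels accessible to
  equations.\<close>

lemma zero_arrow_iff: "zero_arrow A f \<longleftrightarrow> f \<in> Arr A \<and> f = zero (Dom A f) (Cod A f)"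
proof
  assume "zero_arrow A f"
  then have f: "f \<in> Arr A" and "\<exists>z. zero_object A z \<and>
      (\<exists>u \<in> Hom A (Dom A f) z. \<exists>v \<in> Hom A z (Cod A f). f = v \<cdot> u)"
    unfolding zero_arrow_def by blast+
  then obtain z u v where z: "zero_object A z" "u \<in> Hom A (Dom A f) z" "v \<in> Hom A z (Cod A f)"
      and vu: "v \<cdot> u = f"
    by blast
  have "u = zero (Dom A f) z"
    using to_zero_object[of z u] z by (simp add: Hom_iff)
  then have "v \<cdot> u = zero (Dom A f) (Cod A f)"
    using z f by (simp add: Hom_iff)
  then show "f \<in> Arr A \<and> f = zero (Dom A f) (Cod A f)"
    using f vu by simp
next
  assume f: "f \<in> Arr A \<and> f = zero (Dom A f) (Cod A f)"
  obtain z where z: "zero_object A z"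
    using zero_object_ex by blast
  then have "zero z (Cod A f) \<cdot> zero (Dom A f) z = f"
    using f by (simp add: zero_object_Obj)
  then show "zero_arrow A f"
    unfolding zero_arrow_def using f z zero_object_Obj[OF z]
    by (intro conjI exI[of _ z] bexI[of _ "zero (Dom A f) z"] bexI[of _ "zero z (Cod A f)"])
      (simp_all add: Hom_iff)
qed

section \<open>Kernels and cokernels as equations, short exact sequences, images\<close>

lemma is_kernelD:
  assumes "is_kernel A k f"
  shows "k \<in> Arr A" "f \<in> Arr A" "Cod A k = Dom A f" "f \<cdot> k = zero (Dom A k) (Cod A f)" "is_mono A k"
proof -
  show k: "k \<in> Arr A" "f \<in> Arr A" "Cod A k = Dom A f"
    using assms by (auto simp: is_kernel_def)
  then show z: "f \<cdot> k = zero (Dom A k) (Cod A f)"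
    using assms by (auto simp: is_kernel_def zero_arrow_iff)
  show "is_mono A k"
  proof (rule is_monoI)
    fix g h
    assume gh: "g \<in> Arr A" "h \<in> Arr A" "Dom A g = Dom A h" "Cod A g = Dom A k"
      "Cod A h = Dom A k" "k \<cdot> g = k \<cdot> h"
    have "zero_arrow A (f \<cdot> (k \<cdot> h))"
      using k z gh Comp_eq_assoc[OF z, of h] by (simp add: zero_arrow_iff)
    moreover have "k \<cdot> h \<in> Hom A (Dom A h) (Dom A f)"
      using k gh by (simp add: Hom_iff)
    ultimately have "\<exists>!u. u \<in> Hom A (Dom A h) (Dom A k) \<and> k \<cdot> u = k \<cdot> h"
      using assms unfolding is_kernel_def by blast
    then show "g = h"
      using gh by (auto simp: Hom_iff)
  qed (use k in simp)
qed

lemma is_kernel_factorE: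
  assumes "is_kernel A k f" "h \<in> Arr A" "Cod A h = Dom A f" "f \<cdot> h = zero (Dom A h) (Cod A f)"
  obtains u where "u \<in> Arr A" "Dom A u = Dom A h" "Cod A u = Dom A k" "k \<cdot> u = h"
proof -
  have "zero_arrow A (f \<cdot> h)" "h \<in> Hom A (Dom A h) (Dom A f)"
    using assms is_kernelD[OF assms(1)] by (simp_all add: zero_arrow_iff Hom_iff)
  then have "\<exists>!u. u \<in> Hom A (Dom A h) (Dom A k) \<and> k \<cdot> u = h"
    using assms(1)[unfolded is_kernel_def, THEN conjunct2, THEN conjunct2, THEN conjunct2,
        THEN conjunct2, THEN spec, THEN bspec, THEN mp] by simp
  then obtain u where "u \<in> Hom A (Dom A h) (Dom A k)" "k \<cdot> u = h"
    by (elim ex1E conjE)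
  then show thesis
    using that[of u] by (simp add: Hom_iff)
qed

lemma is_kernelI:
  assumes "is_mono A k" "f \<in> Arr A" "Cod A k = Dom A f" "f \<cdot> k = zero (Dom A k) (Cod A f)"
    and "\<And>h. h \<in> Arr A \<Longrightarrow> Cod A h = Dom A f \<Longrightarrow> f \<cdot> h = zero (Dom A h) (Cod A f) \<Longrightarrow>
      \<exists>u \<in> Arr A. Dom A u = Dom A h \<and> Cod A u = Dom A k \<and> k \<cdot> u = h"
  shows "is_kernel A k f"
  unfolding is_kernel_def
proof (intro conjI allI ballI impI)
  show k: "k \<in> Arr A"
    using assms by (simp add: is_mono_arr)
  show "zero_arrow A (f \<cdot> k)"
    using k assms by (simp add: zero_arrow_iff)
next
  fix x h
  assume h: "h \<in> Hom A x (Dom A f)" "zero_arrow A (f \<cdot> h)"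
  then have "f \<cdot> h = zero (Dom A h) (Cod A f)"
    using assms by (simp add: zero_arrow_iff Hom_iff)
  then have "\<exists>u. u \<in> Arr A \<and> Dom A u = Dom A h \<and> Cod A u = Dom A k \<and> k \<cdot> u = h"
    using assms(5)[of h] h by (auto simp: Hom_iff)
  moreover have "u = v" if "u \<in> Arr A" "Cod A u = Dom A k" "v \<in> Arr A" "Cod A v = Dom A k"
      "k \<cdot> u = h" "k \<cdot> v = h" for u v
    using is_mono_cancel[OF assms(1), of u v] that by simp
  ultimately show "\<exists>!u. u \<in> Hom A x (Dom A k) \<and> k \<cdot> u = h"
    using h unfolding Hom_iff by blast
qed (use assms in simp_all)

lemma is_cokernelD:
  assumes "is_cokernel A c f"
  shows "c \<in> Arr A" "f \<in> Arr A" "Dom A c = Cod A f" "c \<cdot> f = zero (Dom A f) (Cod A c)" "is_epi A c"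
proof -
  show c: "c \<in> Arr A" "f \<in> Arr A" "Dom A c = Cod A f"
    using assms by (auto simp: is_cokernel_def)
  then show z: "c \<cdot> f = zero (Dom A f) (Cod A c)"
    using assms by (auto simp: is_cokernel_def zero_arrow_iff)
  show "is_epi A c"
  proof (rule is_epiI)
    fix g h
    assume gh: "g \<in> Arr A" "h \<in> Arr A" "Cod A g = Cod A h" "Dom A g = Cod A c"
      "Dom A h = Cod A c" "g \<cdot> c = h \<cdot> c"
    have "zero_arrow A ((h \<cdot> c) \<cdot> f)"
      using c z gh by (simp add: zero_arrow_iff)
    moreover have "h \<cdot> c \<in> Hom A (Cod A f) (Cod A h)"
      using c gh by (simp add: Hom_iff)
    ultimately have "\<exists>!u. u \<in> Hom A (Cod A c) (Cod A h) \<and> u \<cdot> c = h \<cdot> c"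
      using assms unfolding is_cokernel_def by blast
    then show "g = h"
      using gh by (auto simp: Hom_iff)
  qed (use c in simp)
qed

lemma is_cokernel_factorE:
  assumes "is_cokernel A c f" "h \<in> Arr A" "Dom A h = Cod A f" "h \<cdot> f = zero (Dom A f) (Cod A h)"
  obtains u where "u \<in> Arr A" "Dom A u = Cod A c" "Cod A u = Cod A h" "u \<cdot> c = h"
proof -
  have "zero_arrow A (h \<cdot> f)" "h \<in> Hom A (Cod A f) (Cod A h)"
    using assms is_cokernelD[OF assms(1)] by (simp_all add: zero_arrow_iff Hom_iff)
  then have "\<exists>!u. u \<in> Hom A (Cod A c) (Cod A h) \<and> u \<cdot> c = h"
    using assms(1)[unfolded is_cokernel_def, THEN conjunct2, THEN conjunct2, THEN conjunct2,
        THEN conjunct2, THEN spec, THEN bspec, THEN mp] by simp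
  then obtain u where "u \<in> Hom A (Cod A c) (Cod A h)" "u \<cdot> c = h"
    by (elim ex1E conjE)
  then show thesis
    using that[of u] by (simp add: Hom_iff)
qed

lemma is_cokernelI:
  assumes "is_epi A c" "f \<in> Arr A" "Dom A c = Cod A f" "c \<cdot> f = zero (Dom A f) (Cod A c)"
    and "\<And>h. h \<in> Arr A \<Longrightarrow> Dom A h = Cod A f \<Longrightarrow> h \<cdot> f = zero (Dom A f) (Cod A h) \<Longrightarrow>
      \<exists>u \<in> Arr A. Dom A u = Cod A c \<and> Cod A u = Cod A h \<and> u \<cdot> c = h"
  shows "is_cokernel A c f"
  unfolding is_cokernel_def
proof (intro conjI allI ballI impI)
  show c: "c \<in> Arr A"
    using assms by (simp add: is_epi_arr)
  show "zero_arrow A (c \<cdot> f)"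
    using c assms by (simp add: zero_arrow_iff)
next
  fix x h
  assume h: "h \<in> Hom A (Cod A f) x" "zero_arrow A (h \<cdot> f)"
  then have "h \<cdot> f = zero (Dom A f) (Cod A h)"
    using assms by (simp add: zero_arrow_iff Hom_iff)
  then have "\<exists>u. u \<in> Arr A \<and> Dom A u = Cod A c \<and> Cod A u = Cod A h \<and> u \<cdot> c = h"
    using assms(5)[of h] h by (auto simp: Hom_iff)
  moreover have "u = v" if "u \<in> Arr A" "Dom A u = Cod A c" "v \<in> Arr A" "Dom A v = Cod A c"
      "u \<cdot> c = h" "v \<cdot> c = h" for u v
    using is_epi_cancel[OF assms(1), of u v] that by simp
  ultimately show "\<exists>!u. u \<in> Hom A (Cod A c) x \<and> u \<cdot> c = h"
    using h unfolding Hom_iff by blast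
qed (use assms in simp_all)

text \<open>A mono is a kernel of some \<open>g\<close>. Since \<open>g\<close> kills
  \<open>m\<close>, it factors through the cokernel \<open>c\<close>; whatever \<open>c\<close>
  kills is therefore killed by \<open>g\<close> and lifts through \<open>m\<close>.\<close>

lemma mono_short_exact:
  assumes "is_mono A m"
  obtains c where "short_exact A m c"
proof -
  obtain g where g: "is_kernel A m g"
    using mono_kernel[OF assms] by blast
  obtain c where c: "is_cokernel A c m"
    using cokernel_ex[OF is_mono_arr[OF assms]] by blast
  note gD = is_kernelD[OF g] and cD = is_cokernelD[OF c]
  obtain g' where g': "g' \<in> Arr A" "Dom A g' = Cod A c" "Cod A g' = Cod A g" "g' \<cdot> c = g"
    using is_cokernel_factorE[OF c, of g] gD by auto
  have "is_kernel A m c"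
  proof (rule is_kernelI)
    fix h
    assume h: "h \<in> Arr A" "Cod A h = Dom A c" "c \<cdot> h = zero (Dom A h) (Cod A c)"
    have "g \<cdot> h = g' \<cdot> (c \<cdot> h)"
      using h g' gD cD by (metis Comp_assoc_arr)
    also have "\<dots> = zero (Dom A h) (Cod A g)"
      using h g' by simp
    finally show "\<exists>u \<in> Arr A. Dom A u = Dom A h \<and> Cod A u = Dom A m \<and> m \<cdot> u = h"
      using is_kernel_factorE[OF g, of h] h gD cD by (metis (no_types))
  qed (use assms cD in simp_all)
  then show thesis
    using c that by (simp add: short_exact_def)
qed

text \<open>The dual argument. The kernel is a parameter because the callers start from a particular
  one.\<close>

lemma epi_short_exact:
  assumes "is_epi A e" "is_kernel A k e"
  shows "short_exact A k e"
proof -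
  obtain g where g: "is_cokernel A e g"
    using epi_cokernel[OF assms(1)] by blast
  note gD = is_cokernelD[OF g] and kD = is_kernelD[OF assms(2)]
  obtain g' where g': "g' \<in> Arr A" "Cod A g' = Dom A k" "Dom A g' = Dom A g" "k \<cdot> g' = g"
    using is_kernel_factorE[OF assms(2), of g] gD by auto
  have "is_cokernel A e k"
  proof (rule is_cokernelI)
    fix h
    assume h: "h \<in> Arr A" "Dom A h = Cod A k" "h \<cdot> k = zero (Dom A k) (Cod A h)"
    have "h \<cdot> (k \<cdot> g') = (h \<cdot> k) \<cdot> g'"
      using h(1,2) g'(1-3) gD(1-3) kD(1-3) by simp
    then have "h \<cdot> g = (h \<cdot> k) \<cdot> g'"
      by (simp only: g'(4))
    also have "\<dots> = zero (Dom A g) (Cod A h)"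
      using h g' by simp
    finally show "\<exists>u \<in> Arr A. Dom A u = Cod A e \<and> Cod A u = Cod A h \<and> u \<cdot> e = h"
      using is_cokernel_factorE[OF g, of h] h gD kD by (metis (no_types))
  qed (use assms kD in simp_all)
  then show ?thesis
    using assms by (simp add: short_exact_def)
qed

lemma is_monoI_zero:
  assumes "m \<in> Arr A"
    and "\<And>h. h \<in> Arr A \<Longrightarrow> Cod A h = Dom A m \<Longrightarrow> m \<cdot> h = zero (Dom A h) (Cod A m) \<Longrightarrow>
      h = zero (Dom A h) (Dom A m)"
  shows "is_mono A m"
proof (rule is_monoI)
  fix g h
  assume gh: "g \<in> Arr A" "h \<in> Arr A" "Dom A g = Dom A h" "Cod A g = Dom A m"
    "Cod A h = Dom A m" "m \<cdot> g = m \<cdot> h"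
  obtain d where d: "d \<in> Arr A" "Dom A d = Dom A h" "Cod A d = Cod A h"
    "d = zero (Dom A h) (Cod A h) \<longleftrightarrow> g = h"
    "\<And>k. k \<in> Arr A \<Longrightarrow> Dom A k = Cod A h \<Longrightarrow> k \<cdot> d = zero (Dom A h) (Cod A k) \<longleftrightarrow> k \<cdot> g = k \<cdot> h"
    using differenceE[of g h] gh by (metis (no_types))
  show "g = h"
    using d(1-4) d(5)[of m] gh assms(1) assms(2)[of d] by simp
qed (use assms in simp)

lemma is_epiI_zero:
  assumes "e \<in> Arr A"
    and "\<And>h. h \<in> Arr A \<Longrightarrow> Dom A h = Cod A e \<Longrightarrow> h \<cdot> e = zero (Dom A e) (Cod A h) \<Longrightarrow>
      h = zero (Cod A e) (Cod A h)"
  shows "is_epi A e"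
proof (rule is_epiI)
  fix g h
  assume gh: "g \<in> Arr A" "h \<in> Arr A" "Cod A g = Cod A h" "Dom A g = Cod A e"
    "Dom A h = Cod A e" "g \<cdot> e = h \<cdot> e"
  obtain d where d: "d \<in> Arr A" "Dom A d = Dom A h" "Cod A d = Cod A h"
    "d = zero (Dom A h) (Cod A h) \<longleftrightarrow> g = h"
    "\<And>k. k \<in> Arr A \<Longrightarrow> Cod A k = Dom A h \<Longrightarrow> d \<cdot> k = zero (Dom A k) (Cod A h) \<longleftrightarrow> g \<cdot> k = h \<cdot> k"
    using differenceE[of g h] gh by (metis (no_types))
  show "g = h"
    using d(1-4) d(5)[of e] gh assms(1) assms(2)[of d] by simp
qed (use assms in simp)

text \<open>The image is the kernel of the cokernel of \<open>f\<close>. That the induced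
  \<open>e\<close> is epi expresses the minimality of this subobject: if \<open>d\<close> kills
  \<open>e\<close>, then \<open>f\<close> already factors through the smaller subobject cut out by
  the kernel of \<open>d\<close>.\<close>

lemma image_factorization:
  assumes f: "f \<in> Arr A"
  obtains m e where "is_mono A m" "is_epi A e" "Cod A e = Dom A m" "m \<cdot> e = f"
proof -
  obtain c where c: "is_cokernel A c f"
    using cokernel_ex[OF f] by blast
  note cD = is_cokernelD[OF c]
  obtain m where m: "is_kernel A m c"
    using kernel_ex[OF cD(1)] by blast
  note mD = is_kernelD[OF m]
  obtain e where e: "e \<in> Arr A" "Dom A e = Dom A f" "Cod A e = Dom A m" "m \<cdot> e = f"
    using is_kernel_factorE[OF m, of f] cD by auto
  have "is_epi A e"
  proof (rule is_epiI_zero)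
    fix d
    assume d: "d \<in> Arr A" "Dom A d = Cod A e" "d \<cdot> e = zero (Dom A e) (Cod A d)"
    obtain l where l: "is_kernel A l d"
      using kernel_ex[OF d(1)] by blast
    note lD = is_kernelD[OF l]
    obtain e' where e': "e' \<in> Arr A" "Dom A e' = Dom A e" "Cod A e' = Dom A l" "l \<cdot> e' = e"
      using is_kernel_factorE[OF l, of e] d e by auto
    \<comment> \<open>The mono \<open>m \<cdot> l\<close>, through which \<open>f\<close> factors,
      is the kernel of some \<open>u\<close>. Then \<open>u\<close> kills \<open>f\<close>, hence
      factors through \<open>c\<close> and kills \<open>m\<close>. So \<open>m\<close> factors back
      through \<open>m \<cdot> l\<close>, which gives a right inverse \<open>s\<close> of
      \<open>l\<close> and forces \<open>d\<close> to vanish.\<close>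
    have "is_mono A (m \<cdot> l)"
      using mD lD d e by (intro is_mono_Comp) simp_all
    then obtain u where u: "is_kernel A (m \<cdot> l) u"
      using mono_kernel by blast
    note uD = is_kernelD[OF u]
    have uml: "u \<cdot> (m \<cdot> l) = zero (Dom A l) (Cod A u)" and domu: "Dom A u = Cod A m"
      using uD mD lD d e by simp_all
    have "f = (m \<cdot> l) \<cdot> e'"
      using e e' mD(1) lD(1,3) d(2) by simp
    then have "u \<cdot> f = (u \<cdot> (m \<cdot> l)) \<cdot> e'"
      using uD(2) mD(1) lD(1,3) d(2) e'(1,3) e(3) domu by simp
    also have "\<dots> = zero (Dom A f) (Cod A u)"
      using uD(2) e'(1-3) lD(1) e(2) by (simp add: uml)
    finally obtain u' where u': "u' \<in> Arr A" "Dom A u' = Cod A c" "Cod A u' = Cod A u" "u' \<cdot> c = u"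
      using is_cokernel_factorE[OF c, of u] uD mD cD domu by auto
    have "u \<cdot> m = u' \<cdot> (c \<cdot> m)"
      using u' mD by (metis Comp_assoc_arr)
    also have "\<dots> = zero (Dom A m) (Cod A u)"
      using u' mD by simp
    finally obtain s where s: "s \<in> Arr A" "Dom A s = Dom A m" "Cod A s = Dom A l" "(m \<cdot> l) \<cdot> s = m"
      using is_kernel_factorE[OF u, of m] mD domu lD d e by auto
    have "l \<cdot> s = Ident A (Dom A m)"
      using is_mono_cancel[OF mD(5), of "l \<cdot> s" "Ident A (Dom A m)"] s mD lD d e by simp
    then have "d = d \<cdot> (l \<cdot> s)"
      using d e by simp
    also have "\<dots> = (d \<cdot> l) \<cdot> s"
      using d(1,2) e(3) lD(1,3) s(1-3) by simp
    also have "\<dots> = zero (Cod A e) (Cod A d)"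
      using s(1-3) d(1,2) e(3) by (simp add: lD(4))
    finally show "d = zero (Cod A e) (Cod A d)" .
  qed (use e in simp)
  then show thesis
    using that mD e by blast
qed

text \<open>Its purpose is to replace an arrow by the epi part of its image factorization, for which
  a kernel becomes the left end of a short exact sequence.\<close>

lemma is_kernel_mono_Comp:
  assumes k: "is_kernel A k (n \<cdot> f)" and n: "is_mono A n" and f: "f \<in> Arr A" "Cod A f = Dom A n"
  shows "is_kernel A k f"
proof -
  note kD = is_kernelD[OF k] and nA = is_mono_arr[OF n]
  have ck: "Cod A k = Dom A f"
    using kD(3) f nA by simp
  show ?thesis
  proof (rule is_kernelI)
    have "n \<cdot> (f \<cdot> k) = n \<cdot> zero (Dom A k) (Dom A n)"
      using kD(1,4) f nA ck by simp
    then show "f \<cdot> k = zero (Dom A k) (Cod A f)"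
      using is_mono_cancel[OF n, of "f \<cdot> k" "zero (Dom A k) (Dom A n)"] kD(1) f nA ck by simp
  next
    fix h
    assume h: "h \<in> Arr A" "Cod A h = Dom A f" "f \<cdot> h = zero (Dom A h) (Cod A f)"
    have "(n \<cdot> f) \<cdot> h = n \<cdot> (f \<cdot> h)"
      using h(1,2) f nA by simp
    also have "\<dots> = zero (Dom A h) (Cod A (n \<cdot> f))"
      using h f nA by simp
    finally obtain u where "u \<in> Arr A" "Dom A u = Dom A h" "Cod A u = Dom A k" "k \<cdot> u = h"
      using is_kernel_factorE[OF k, of h] h(1,2) f nA by auto
    then show "\<exists>u \<in> Arr A. Dom A u = Dom A h \<and> Cod A u = Dom A k \<and> k \<cdot> u = h"
      by blast
  qed (use kD f ck in simp_all)
qed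

text \<open>
  The case of the pullback of an epimorphism that is needed here: \<open>ker (v \<cdot> e)\<close> is the preimage of
  \<open>ker v\<close> under \<open>e\<close>.
\<close>

lemma epi_on_kernels:
  assumes e: "is_epi A e" and y: "is_kernel A y (v \<cdot> e)" and l: "is_kernel A l v"
    and t: "t \<in> Arr A" "Dom A t = Dom A y" "Cod A t = Dom A l" "l \<cdot> t = e \<cdot> y"
    and ev: "Cod A e = Dom A v"
  shows "is_epi A t"
proof -
  note eA = is_epi_arr[OF e] and lD = is_kernelD[OF l]
  have yD: "y \<in> Arr A" "Cod A y = Dom A e"
    using is_kernelD[OF y] eA lD ev by auto
  \<comment> \<open>The aim is that the image \<open>m\<close> of \<open>t\<close> is all of
    \<open>Dom A l\<close>. For this the cokernel \<open>c\<close> of \<open>l \<cdot> m\<close> is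
    shown to kill \<open>l\<close>; then \<open>l\<close> factors through
    \<open>l \<cdot> m\<close>, and \<open>m\<close> has a right inverse.\<close>
  obtain m t' where mt: "is_mono A m" "is_epi A t'" "Cod A t' = Dom A m" "m \<cdot> t' = t"
    using image_factorization[OF t(1)] .
  note mtA = is_mono_arr[OF mt(1)] is_epi_arr[OF mt(2)]
  have m: "Cod A m = Dom A l" "Dom A t' = Dom A y"
    using mt mtA t by auto
  have "is_mono A (l \<cdot> m)"
    using mt lD m by (intro is_mono_Comp) simp_all
  then obtain c where c: "short_exact A (l \<cdot> m) c"
    by (rule mono_short_exact)
  then have ck: "is_kernel A (l \<cdot> m) c"
    by (simp add: short_exact_def)
  have cD: "c \<in> Arr A" "Dom A c = Dom A v" "c \<cdot> (l \<cdot> m) = zero (Dom A m) (Cod A c)"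
    using is_kernelD[OF ck] lD mtA m by auto
  \<comment> \<open>Replacing \<open>v\<close> by its epi part \<open>b\<close> makes
    \<open>b \<cdot> e\<close> an epi with kernel \<open>y\<close>, hence the cokernel of
    \<open>y\<close>. As \<open>c \<cdot> e\<close> kills \<open>y\<close>, it factors through
    \<open>b \<cdot> e\<close>, so \<open>c\<close> factors through \<open>b\<close>, which kills
    \<open>l\<close>.\<close>
  obtain n b where nb: "is_mono A n" "is_epi A b" "Cod A b = Dom A n" "n \<cdot> b = v"
    using image_factorization lD(2) by metis
  note nbA = is_mono_arr[OF nb(1)] is_epi_arr[OF nb(2)]
  have b: "Dom A b = Dom A v"
    using nb nbA by auto
  have nbe: "n \<cdot> (b \<cdot> e) = v \<cdot> e"
    using nb nbA eA ev b by (metis Comp_assoc_arr)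
  have be: "is_epi A (b \<cdot> e)"
    using nb e ev b by (intro is_epi_Comp) simp_all
  have "is_kernel A y (b \<cdot> e)"
    using is_kernel_mono_Comp[of y n "b \<cdot> e"] y nbe nb(1,3) nbA eA ev b by simp
  then have cok: "is_cokernel A (b \<cdot> e) y"
    using epi_short_exact[OF be] by (simp add: short_exact_def)
  have "(c \<cdot> e) \<cdot> y = c \<cdot> (l \<cdot> t)"
    using cD eA ev yD t by simp
  also have "\<dots> = (c \<cdot> (l \<cdot> m)) \<cdot> t'"
    using cD(1,2) lD(1-3) mtA m mt(3) by (simp add: mt(4)[symmetric])
  also have "\<dots> = zero (Dom A y) (Cod A (c \<cdot> e))"
    using cD mtA mt m eA ev by simp
  finally obtain g where g: "g \<in> Arr A" "Dom A g = Cod A b" "Cod A g = Cod A c" "g \<cdot> (b \<cdot> e) = c \<cdot> e"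
    using is_cokernel_factorE[OF cok, of "c \<cdot> e"] cD eA ev yD nbA b by auto
  have "g \<cdot> b = c"
    using is_epi_cancel[OF e, of "g \<cdot> b" c] g cD ev nbA b eA by simp
  then have "c \<cdot> l = g \<cdot> (b \<cdot> l)"
    using Comp_assoc_arr[of l b g] g(1,2) lD(1,3) nbA b by simp
  moreover have "b \<cdot> l = zero (Dom A l) (Dom A n)"
  proof -
    have "n \<cdot> (b \<cdot> l) = n \<cdot> zero (Dom A l) (Dom A n)"
      using Comp_eq_assoc[OF nb(4), of l] lD(1-3) nb(3) nbA b Cod_Comp[of b n]
      by (simp add: lD(4) nb(4))
    then show ?thesis
      using is_mono_cancel[OF nb(1), of "b \<cdot> l" "zero (Dom A l) (Dom A n)"] lD nb nbA b by simp
  qed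
  ultimately have "c \<cdot> l = zero (Dom A l) (Cod A c)"
    using g(1-3) lD(1) nb(3) by simp
  then obtain s where s: "s \<in> Arr A" "Dom A s = Dom A l" "Cod A s = Dom A m" "(l \<cdot> m) \<cdot> s = l"
    using is_kernel_factorE[OF ck, of l] lD cD m mtA by auto
  then have ms: "m \<cdot> s = Ident A (Dom A l)"
    using is_mono_cancel[OF lD(5), of "m \<cdot> s" "Ident A (Dom A l)"] lD mtA m by simp
  have "is_epi A (m \<cdot> s)"
    using ms lD is_iso_is_epi[OF is_iso_Ident] by simp
  then have "is_epi A m"
    using is_epi_left[of m s] mtA m s by simp
  then show ?thesis
    using is_epi_Comp[OF mt(2)] mt m by auto
qed

end

section \<open>Thick subcategories and Serre quotients\<close>

locale thick_abelian = abelian A add zero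
  for A :: "('o, 'a) cat" (structure) and add zero +
  fixes C :: "'o set"
  assumes thick: "thick A C"
begin

section \<open>Closure properties of a thick subcategory\<close>

lemma thick_Obj: "x \<in> C \<Longrightarrow> x \<in> Obj A"
  using thick by (auto simp: thick_def)

lemma thick_iff: "short_exact A i p \<Longrightarrow> Cod A i \<in> C \<longleftrightarrow> Dom A i \<in> C \<and> Cod A p \<in> C"
  using thick by (simp add: thick_def)

lemma Dom_mono_thick:
  assumes "is_mono A m" "Cod A m \<in> C"
  shows "Dom A m \<in> C"
  using mono_short_exact[OF assms(1)] thick_iff assms(2) by metis

lemma Cod_epi_thick:
  assumes "is_epi A e" "Dom A e \<in> C"
  shows "Cod A e \<in> C"
proof -
  obtain k where "is_kernel A k e"
    using kernel_ex is_epi_arr[OF assms(1)] by blast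
  then show ?thesis
    using epi_short_exact[OF assms(1), of k] thick_iff[of k e] is_kernelD(3)[of k e] assms(2) by simp
qed

text \<open>\<open>thick\<close> asks for some object \<open>c\<close> of \<open>C\<close>, and the
  zero object is a quotient of \<open>c\<close>.\<close>

lemma zero_object_thick:
  assumes z: "zero_object A z"
  shows "z \<in> C"
proof -
  obtain c where c: "c \<in> C"
    using thick by (auto simp: thick_def)
  have "is_epi A (zero c z)"
    using from_zero_object[OF z] zero_object_Obj[OF z] thick_Obj[OF c]
    by (intro is_epiI_zero) simp_all
  then show ?thesis
    using Cod_epi_thick[of "zero c z"] c zero_object_Obj[OF z] thick_Obj[OF c] by simp
qed

text \<open>The quotient by the kernel of \<open>g\<close> is the image of \<open>g\<close>, a
  subobject of \<open>Cod A g\<close>. This criterion allows \<open>g\<close> to be any arrow into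
  an object of \<open>C\<close>, epi or not.\<close>

lemma sub_mod_in_kernel:
  assumes l: "is_kernel A l g" and g: "Cod A g \<in> C"
  shows "sub_mod_in A C l"
proof -
  obtain m e where me: "is_mono A m" "is_epi A e" "Cod A e = Dom A m" "m \<cdot> e = g"
    using image_factorization[OF is_kernelD(2)[OF l]] .
  note meA = is_mono_arr[OF me(1)] is_epi_arr[OF me(2)]
  have "is_kernel A l e"
    using is_kernel_mono_Comp[of l m e] l me meA by simp
  then have "short_exact A l e"
    using epi_short_exact me(2) by blast
  moreover have "Cod A m = Cod A g"
    using me(3,4) meA by auto
  then have "Cod A e \<in> C"
    using Dom_mono_thick[OF me(1)] g me(3) by simp
  ultimately show ?thesis
    by (auto simp: sub_mod_in_def)
qed

lemma quot_by_in_epi: "is_epi A e \<Longrightarrow> is_kernel A n e \<Longrightarrow> Dom A n \<in> C \<Longrightarrow> quot_by_in A C e"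
  unfolding quot_by_in_def using epi_short_exact by blast

lemma sub_mod_in_is_mono: "sub_mod_in A C i \<Longrightarrow> is_mono A i"
  using is_kernelD(5) by (auto simp: sub_mod_in_def short_exact_def)

lemma quot_by_in_is_epi: "quot_by_in A C p \<Longrightarrow> is_epi A p"
  using is_cokernelD(5) by (auto simp: quot_by_in_def short_exact_def)

lemma sub_mod_in_arr [simp]: "sub_mod_in A C i \<Longrightarrow> i \<in> Arr A"
  using sub_mod_in_is_mono is_mono_arr by blast

lemma quot_by_in_arr [simp]: "quot_by_in A C p \<Longrightarrow> p \<in> Arr A"
  using quot_by_in_is_epi is_epi_arr by blast

lemma is_kernel_zero_Ident:
  assumes z: "zero_object A z" and x: "x \<in> Obj A"
  shows "is_kernel A (zero z x) (Ident A x)"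
proof (rule is_kernelI)
  show "is_mono A (zero z x)"
    using to_zero_object[OF z] zero_object_Obj[OF z] x by (intro is_monoI_zero) simp_all
next
  fix h
  assume h: "h \<in> Arr A" "Cod A h = Dom A (Ident A x)"
    "Ident A x \<cdot> h = zero (Dom A h) (Cod A (Ident A x))"
  then have "zero z x \<cdot> zero (Dom A h) z = h"
    using x zero_object_Obj[OF z] by simp
  then show "\<exists>u \<in> Arr A. Dom A u = Dom A h \<and> Cod A u = Dom A (zero z x) \<and> zero z x \<cdot> u = h"
    using h(1) x zero_object_Obj[OF z] by (intro bexI[of _ "zero (Dom A h) z"]) simp_all
qed (use x zero_object_Obj[OF z] in simp_all)

lemma sub_mod_in_Ident [simp]:
  assumes "x \<in> Obj A"
  shows "sub_mod_in A C (Ident A x)"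
proof -
  obtain z where z: "zero_object A z"
    using zero_object_ex by blast
  have "is_kernel A (Ident A x) (zero x z)"
  proof (rule is_kernelI)
    show "is_mono A (Ident A x)"
      using assms by (simp add: is_iso_Ident is_iso_is_mono)
  next
    fix h
    assume "h \<in> Arr A" "Cod A h = Dom A (zero x z)"
    then show "\<exists>u \<in> Arr A. Dom A u = Dom A h \<and> Cod A u = Dom A (Ident A x) \<and> Ident A x \<cdot> u = h"
      using assms zero_object_Obj[OF z] by (intro bexI[of _ h]) simp_all
  qed (use assms zero_object_Obj[OF z] in simp_all)
  then show ?thesis
    by (rule sub_mod_in_kernel) (use assms z zero_object_Obj[OF z] zero_object_thick in simp)
qed

lemma quot_by_in_Ident [simp]:
  assumes "x \<in> Obj A"
  shows "quot_by_in A C (Ident A x)"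
proof -
  obtain z where z: "zero_object A z"
    using zero_object_ex by blast
  show ?thesis
    using quot_by_in_epi[OF _ is_kernel_zero_Ident[OF z assms]] zero_object_thick[OF z] assms
      zero_object_Obj[OF z] by (simp add: is_iso_Ident is_iso_is_epi)
qed

text \<open>The fraction \<open>Q(p)\<^sup>-\<^sup>1 \<cdot> Q(f) \<cdot> Q(i)\<^sup>-\<^sup>1\<close>.\<close>

definition frac :: "'a \<Rightarrow> 'a \<Rightarrow> 'a \<Rightarrow> 'o \<times> 'o \<times> ('a \<times> 'a \<times> 'a) set" where
  "frac i f p = (Cod A i, Dom A p, lim_class A C (Cod A i) (Dom A p) (i, f, p))"

section \<open>Representatives of arrows of the Serre quotient\<close>

lemma in_reps_iff: "(i, f, p) \<in> reps A C M N \<longleftrightarrow> sub_mod_in A C i \<and> Cod A i = M \<and>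
    quot_by_in A C p \<and> Dom A p = N \<and> f \<in> Arr A \<and> Dom A f = Dom A i \<and> Cod A f = Cod A p"
  by (simp add: reps_def Hom_iff)

lemma stage_mapI:
  assumes "sub_mod_in A C k" "quot_by_in A C r" "a \<in> Hom A (Dom A k) (Dom A i)"
    "b \<in> Hom A (Cod A p) (Cod A r)" "k = i \<cdot> a" "r = b \<cdot> p" "h = b \<cdot> f \<cdot> a"
  shows "stage_map A C (i, f, p) (k, h, r)"
  using assms unfolding stage_map_def by blast

text \<open>With identities as denominators the comparison arrows can only be \<open>k\<close> and
  \<open>r\<close> themselves, so the later stages of an arrow \<open>f\<close> of \<open>A\<close>
  are obtained by restricting along \<open>k\<close> and projecting along \<open>r\<close>.\<close>

lemma stage_map_IdentD:
  assumes "stage_map A C (Ident A (Dom A f), f, Ident A (Cod A f)) (k, h, r)" "f \<in> Arr A"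
  shows "sub_mod_in A C k \<and> quot_by_in A C r \<and> Cod A k = Dom A f \<and> Dom A r = Cod A f \<and>
    h = r \<cdot> (f \<cdot> k)"
proof -
  obtain a b where "sub_mod_in A C k" "quot_by_in A C r"
    and ab: "a \<in> Hom A (Dom A k) (Dom A (Ident A (Dom A f)))"
      "b \<in> Hom A (Cod A (Ident A (Cod A f))) (Cod A r)"
      "k = Ident A (Dom A f) \<cdot> a" "r = b \<cdot> Ident A (Cod A f)" "h = b \<cdot> f \<cdot> a"
    using assms(1) unfolding stage_map_def prod.case by (elim conjE bexE)
  moreover have eq: "a = k" "b = r"
    using ab(1-4) assms(2) by (simp_all add: Hom_iff)
  ultimately show ?thesis
    using ab(1,2,5) assms(2) unfolding eq by (simp add: Hom_iff)
qed

lemma stage_map_refl: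
  assumes "(i, f, p) \<in> reps A C M N"
  shows "stage_map A C (i, f, p) (i, f, p)"
  by (rule stage_mapI[where a = "Ident A (Dom A i)" and b = "Ident A (Cod A p)"])
    (use assms in \<open>auto simp: in_reps_iff Hom_iff\<close>)

lemma rep_equiv_sym: "rep_equiv A C x y \<Longrightarrow> rep_equiv A C y x"
  by (auto simp: rep_equiv_def)

lemma in_lim_class_self: "x \<in> reps A C M N \<Longrightarrow> x \<in> lim_class A C M N x"
  unfolding lim_class_def rep_equiv_def by (cases x) (use stage_map_refl in blast)

lemma rep_compI:
  assumes "sub_mod_in A C k" "quot_by_in A C r"
    "a \<in> Hom A (Dom A k) (Dom A i)" "b \<in> Hom A (Cod A q) (Cod A r)"
    "e \<in> Hom A (Dom A j) I" "m \<in> Hom A I (Cod A p)" "u \<in> Hom A (Dom A k) I" "w \<in> Hom A I (Cod A r)"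
    "k = i \<cdot> a" "r = b \<cdot> q" "is_epi A e" "is_mono A m" "p \<cdot> j = m \<cdot> e" "f \<cdot> a = m \<cdot> u"
    "b \<cdot> g = w \<cdot> e" "h = w \<cdot> u"
  shows "rep_comp A C (j, g, q) (i, f, p) (k, h, r)"
  unfolding rep_comp_def prod.case using assms
  by (intro conjI bexI[of _ a] bexI[of _ b] exI[of _ I] bexI[of _ e] bexI[of _ m] bexI[of _ u]
      bexI[of _ w])

text \<open>Since \<open>p\<close> is epi, it is its own image, and composing with the identity can
  return the given representative unchanged. This is the input for comparing classes by means of the
  unit law.\<close>

lemma rep_comp_Ident:
  assumes "(i, f, p) \<in> reps A C M N"
  shows "rep_comp A C (Ident A N, Ident A N, Ident A N) (i, f, p) (i, f, p)"
  by (rule rep_compI[where a = "Ident A (Dom A i)" and b = p and e = p and m = "Ident A (Cod A p)"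
        and u = f and w = "Ident A (Cod A p)" and I = "Cod A p"])
    (use assms in \<open>auto simp: in_reps_iff Hom_iff quot_by_in_is_epi is_iso_Ident is_iso_is_mono\<close>)

end

lemma Obj_serre_quotient [simp]: "Obj (serre_quotient A C) = Obj A"
  by (simp add: serre_quotient_def)

lemma ob_quotient_functor [simp]: "ob (quotient_functor A C) x = x"
  by (simp add: quotient_functor_def)

text \<open>The locale takes \<open>A / C\<close> as a category and \<open>Q\<close> as a functor.
  An adjunction with left adjoint \<open>Q\<close> provides both, and with them the compatibility of
  composition with classes.\<close>

locale serre = thick_abelian A add zero C +
  Q: cfunctor A "serre_quotient A C" "quotient_functor A C"
  for A :: "('o, 'a) cat" (structure) and add zero C
begin

abbreviation "AC \<equiv> serre_quotient A C"

abbreviation "Q \<equiv> ar (quotient_functor A C)"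

lemma frac_arr [simp]:
  assumes "sub_mod_in A C i" "quot_by_in A C p" "f \<in> Arr A" "Dom A f = Dom A i" "Cod A f = Cod A p"
  shows "frac i f p \<in> Arr AC"
proof -
  have "Cod A i \<in> Obj A" "Dom A p \<in> Obj A" "(i, f, p) \<in> reps A C (Cod A i) (Dom A p)"
    using assms by (auto simp: in_reps_iff)
  then show ?thesis
    unfolding frac_def serre_quotient_def by auto
qed

lemma Dom_frac [simp]: "Dom AC (frac i f p) = Cod A i"
  and Cod_frac [simp]: "Cod AC (frac i f p) = Dom A p"
  by (simp_all add: frac_def serre_quotient_def)

lemma fracE:
  assumes "\<phi> \<in> Arr AC"
  obtains i f p where "sub_mod_in A C i" "quot_by_in A C p" "f \<in> Arr A" "Dom A f = Dom A i"
    "Cod A f = Cod A p" "\<phi> = frac i f p"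
proof -
  obtain M N x where x: "x \<in> reps A C M N" "\<phi> = (M, N, lim_class A C M N x)"
    using assms by (auto simp: serre_quotient_def)
  obtain i f p where "x = (i, f, p)"
    by (cases x)
  then show thesis
    using that[of i p f] x by (simp add: frac_def in_reps_iff)
qed

lemma Q_eq_frac: "f \<in> Arr A \<Longrightarrow> Q f = frac (Ident A (Dom A f)) f (Ident A (Cod A f))"
  by (simp add: frac_def quotient_functor_def)

lemma Comp_AC: "(N', P, \<psi>) \<cdot>\<^bsub>AC\<^esub> (M, N, \<phi>) =
    (M, P, \<Union>{lim_class A C M P z |x y z. x \<in> \<phi> \<and> y \<in> \<psi> \<and> rep_comp A C y x z})"
  by (simp add: serre_quotient_def)

text \<open>
  The equivalence of representatives is transitive because the composition of \<open>A / C\<close> is unital: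
  the composite of a class with the identity contains the class of each of its elements.
\<close>

lemma lim_class_eq:
  assumes x0: "x0 \<in> reps A C M N" and x: "x \<in> lim_class A C M N x0"
  shows "lim_class A C M N x = lim_class A C M N x0"
proof -
  have sub: "lim_class A C M N x \<subseteq> lim_class A C M N x0"
    if x0: "x0 \<in> reps A C M N" and x: "x \<in> lim_class A C M N x0" for x x0
  proof -
    obtain i f p where ifp: "x0 = (i, f, p)"
      by (cases x0)
    let ?\<phi> = "frac i f p" and ?id = "(Ident A N, Ident A N, Ident A N)"
    have D: "sub_mod_in A C i" "quot_by_in A C p" "f \<in> Arr A" "Dom A f = Dom A i"
      "Cod A f = Cod A p" "Cod A i = M" "Dom A p = N"
      using x0 ifp by (auto simp: in_reps_iff)
    have N: "N \<in> Obj A"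
      using D by auto
    have "?\<phi> \<in> Arr AC"
      using D by simp
    then have "Ident AC N \<cdot>\<^bsub>AC\<^esub> ?\<phi> = ?\<phi>"
      using D by simp
    moreover have "Ident AC N = (N, N, lim_class A C N N ?id)"
      by (simp add: serre_quotient_def)
    moreover have "?\<phi> = (M, N, lim_class A C M N x0)"
      using D ifp by (simp add: frac_def)
    ultimately have "\<Union>{lim_class A C M N z |x y z. x \<in> lim_class A C M N x0 \<and>
        y \<in> lim_class A C N N ?id \<and> rep_comp A C y x z} = lim_class A C M N x0"
      by (simp add: Comp_AC)
    moreover have "?id \<in> lim_class A C N N ?id"
      using N by (intro in_lim_class_self) (simp add: in_reps_iff)
    moreover have "rep_comp A C ?id x x"
    proof -
      have "x \<in> reps A C M N"
        using x by (simp add: lim_class_def)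
      then show ?thesis
        using rep_comp_Ident by (cases x) auto
    qed
    ultimately show ?thesis
      using x by blast
  qed
  have "x \<in> reps A C M N" "x0 \<in> lim_class A C M N x"
    using x x0 rep_equiv_sym by (auto simp: lim_class_def)
  then show ?thesis
    using sub x x0 by blast
qed

lemma frac_eqI:
  assumes "(i, f, p) \<in> reps A C M N" "(j, g, q) \<in> reps A C M N"
    "rep_equiv A C (i, f, p) (j, g, q)"
  shows "frac i f p = frac j g q"
proof -
  have "(j, g, q) \<in> lim_class A C M N (i, f, p)"
    using assms by (simp add: lim_class_def)
  then show ?thesis
    using lim_class_eq[OF assms(1)] assms(1,2) by (simp add: frac_def in_reps_iff)
qed

lemma frac_eqD:
  assumes "frac i f p = frac j g q" "(j, g, q) \<in> reps A C M N"
  shows "rep_equiv A C (i, f, p) (j, g, q)"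
proof -
  have "lim_class A C M N (i, f, p) = lim_class A C M N (j, g, q)"
    using assms by (auto simp: frac_def in_reps_iff)
  then have "(j, g, q) \<in> lim_class A C M N (i, f, p)"
    using in_lim_class_self[OF assms(2)] by simp
  then show ?thesis
    by (simp add: lim_class_def)
qed

text \<open>The composite is defined as a union of classes. Being an arrow of \<open>A / C\<close>,
  it is a single class, hence the class of any one composite of representatives.\<close>

lemma Comp_frac:
  assumes x: "(i, f, p) \<in> reps A C M N" and y: "(j, g, q) \<in> reps A C N P"
    and z: "(k, h, r) \<in> reps A C M P" and c: "rep_comp A C (j, g, q) (i, f, p) (k, h, r)"
  shows "frac j g q \<cdot>\<^bsub>AC\<^esub> frac i f p = frac k h r"
proof -
  have "frac i f p \<in> Arr AC" "frac j g q \<in> Arr AC" "Cod AC (frac i f p) = Dom AC (frac j g q)"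
    using x y by (auto simp: in_reps_iff)
  then have "frac j g q \<cdot>\<^bsub>AC\<^esub> frac i f p \<in> Arr AC"
    by simp
  moreover have eq: "frac j g q \<cdot>\<^bsub>AC\<^esub> frac i f p = (M, P, \<Union>{lim_class A C M P z |x' y' z.
      x' \<in> lim_class A C M N (i, f, p) \<and> y' \<in> lim_class A C N P (j, g, q) \<and> rep_comp A C y' x' z})"
    (is "_ = (M, P, ?U)")
    using x y by (simp add: frac_def Comp_AC in_reps_iff)
  ultimately obtain z' where z': "z' \<in> reps A C M P" "?U = lim_class A C M P z'"
    unfolding serre_quotient_def by auto
  have "lim_class A C M P (k, h, r) \<subseteq> ?U"
    using in_lim_class_self[OF x] in_lim_class_self[OF y] c by blast
  then have "(k, h, r) \<in> lim_class A C M P z'"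
    using in_lim_class_self[OF z] z'(2) by blast
  then have "lim_class A C M P (k, h, r) = ?U"
    using lim_class_eq[OF z'(1)] z'(2) by simp
  then show ?thesis
    using eq z by (simp add: frac_def in_reps_iff)
qed

text \<open>Clearing denominators: once \<open>Q i\<close> and \<open>Q p\<close> are known to be
  invertible, this equation determines the fraction and reduces questions about it to the image of
  \<open>Q\<close>.\<close>

lemma Q_frac_Q:
  assumes "sub_mod_in A C i" "quot_by_in A C p" "f \<in> Arr A" "Dom A f = Dom A i" "Cod A f = Cod A p"
  shows "Q p \<cdot>\<^bsub>AC\<^esub> (frac i f p \<cdot>\<^bsub>AC\<^esub> Q i) = Q f"
proof -
  note [simp] = assms is_iso_Ident is_iso_is_mono is_iso_is_epi quot_by_in_is_epi sub_mod_in_is_mono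
  have "frac i f p \<cdot>\<^bsub>AC\<^esub> frac (Ident A (Dom A i)) i (Ident A (Cod A i))
      = frac (Ident A (Dom A i)) f p"
  proof (rule Comp_frac)
    show "rep_comp A C (i, f, p) (Ident A (Dom A i), i, Ident A (Cod A i)) (Ident A (Dom A i), f, p)"
      by (rule rep_compI[where a = "Ident A (Dom A i)" and b = "Ident A (Cod A p)" and I = "Dom A i"
            and e = "Ident A (Dom A i)" and m = i and u = "Ident A (Dom A i)" and w = f])
        (simp_all add: Hom_iff)
  qed (simp_all add: in_reps_iff)
  moreover have "frac (Ident A (Dom A p)) p (Ident A (Cod A p)) \<cdot>\<^bsub>AC\<^esub> frac (Ident A (Dom A i)) f p
      = frac (Ident A (Dom A i)) f (Ident A (Cod A p))"
  proof (rule Comp_frac)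
    show "rep_comp A C (Ident A (Dom A p), p, Ident A (Cod A p)) (Ident A (Dom A i), f, p)
        (Ident A (Dom A i), f, Ident A (Cod A p))"
      by (rule rep_compI[where a = "Ident A (Dom A i)" and b = "Ident A (Cod A p)" and I = "Cod A p"
            and e = p and m = "Ident A (Cod A p)" and u = f and w = "Ident A (Cod A p)"])
        (simp_all add: Hom_iff)
  qed (simp_all add: in_reps_iff)
  ultimately show ?thesis
    by (simp add: Q_eq_frac)
qed

text \<open>The inverse is the identity of \<open>Dom A i\<close>, read as an arrow out of
  \<open>Cod A i\<close> that is defined on the subobject \<open>i\<close> only. Composing it with
  \<open>Q i\<close> gives the inclusion \<open>i\<close> on that subobject, which is a later stage
  of the identity of \<open>Cod A i\<close>.\<close>

lemma is_iso_Q_sub_mod_in: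
  assumes i: "sub_mod_in A C i"
  shows "is_iso AC (Q i)"
proof (rule Q.B.is_isoI)
  note [simp] = i is_iso_Ident is_iso_is_mono is_iso_is_epi sub_mod_in_is_mono
  let ?M = "Dom A i" and ?N = "Cod A i"
  let ?g = "frac i (Ident A ?M) (Ident A ?M)"
  show "Q i \<in> Arr AC" "?g \<in> Arr AC" "Dom AC ?g = Cod AC (Q i)" "Cod AC ?g = Dom AC (Q i)"
    by simp_all
  have "?g \<cdot>\<^bsub>AC\<^esub> frac (Ident A ?M) i (Ident A ?N) = frac (Ident A ?M) (Ident A ?M) (Ident A ?M)"
  proof (rule Comp_frac)
    show "rep_comp A C (i, Ident A ?M, Ident A ?M) (Ident A ?M, i, Ident A ?N)
        (Ident A ?M, Ident A ?M, Ident A ?M)"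
      by (rule rep_compI[where a = "Ident A ?M" and b = "Ident A ?M" and I = ?M
            and e = "Ident A ?M" and m = i and u = "Ident A ?M" and w = "Ident A ?M"])
        (simp_all add: Hom_iff)
  qed (simp_all add: in_reps_iff)
  then show "?g \<cdot>\<^bsub>AC\<^esub> Q i = Ident AC (Dom AC (Q i))"
    using Q.ar_Ident[of ?M] by (simp add: Q_eq_frac)
  have "frac (Ident A ?M) i (Ident A ?N) \<cdot>\<^bsub>AC\<^esub> ?g = frac i i (Ident A ?N)"
  proof (rule Comp_frac)
    show "rep_comp A C (Ident A ?M, i, Ident A ?N) (i, Ident A ?M, Ident A ?M) (i, i, Ident A ?N)"
      by (rule rep_compI[where a = "Ident A ?M" and b = "Ident A ?N" and I = ?M
            and e = "Ident A ?M" and m = "Ident A ?M" and u = "Ident A ?M" and w = i])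
        (simp_all add: Hom_iff)
  qed (simp_all add: in_reps_iff)
  also have "\<dots> = frac (Ident A ?N) (Ident A ?N) (Ident A ?N)"
  proof (rule frac_eqI)
    have "stage_map A C (Ident A ?N, Ident A ?N, Ident A ?N) (i, i, Ident A ?N)"
      by (rule stage_mapI[where a = i and b = "Ident A ?N"]) (simp_all add: Hom_iff)
    moreover have "stage_map A C (i, i, Ident A ?N) (i, i, Ident A ?N)"
      by (rule stage_map_refl[of _ _ _ ?N ?N]) (simp add: in_reps_iff)
    ultimately show "rep_equiv A C (i, i, Ident A ?N) (Ident A ?N, Ident A ?N, Ident A ?N)"
      unfolding rep_equiv_def by blast
  qed (simp_all add: in_reps_iff)
  finally show "Q i \<cdot>\<^bsub>AC\<^esub> ?g = Ident AC (Cod AC (Q i))"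
    using Q.ar_Ident[of ?N] by (simp add: Q_eq_frac)
qed

text \<open>Dually, the inverse is the identity of \<open>Cod A p\<close>, read as an arrow into
  \<open>Dom A p\<close> that is determined modulo the kernel of \<open>p\<close> only.\<close>

lemma is_iso_Q_quot_by_in:
  assumes p: "quot_by_in A C p"
  shows "is_iso AC (Q p)"
proof (rule Q.B.is_isoI)
  note [simp] = p is_iso_Ident is_iso_is_mono is_iso_is_epi quot_by_in_is_epi
  let ?M = "Dom A p" and ?N = "Cod A p"
  let ?g = "frac (Ident A ?N) (Ident A ?N) p"
  show "Q p \<in> Arr AC" "?g \<in> Arr AC" "Dom AC ?g = Cod AC (Q p)" "Cod AC ?g = Dom AC (Q p)"
    by simp_all
  have "frac (Ident A ?M) p (Ident A ?N) \<cdot>\<^bsub>AC\<^esub> ?g = frac (Ident A ?N) (Ident A ?N) (Ident A ?N)"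
  proof (rule Comp_frac)
    show "rep_comp A C (Ident A ?M, p, Ident A ?N) (Ident A ?N, Ident A ?N, p)
        (Ident A ?N, Ident A ?N, Ident A ?N)"
      by (rule rep_compI[where a = "Ident A ?N" and b = "Ident A ?N" and I = ?N
            and e = p and m = "Ident A ?N" and u = "Ident A ?N" and w = "Ident A ?N"])
        (simp_all add: Hom_iff)
  qed (simp_all add: in_reps_iff)
  then show "Q p \<cdot>\<^bsub>AC\<^esub> ?g = Ident AC (Cod AC (Q p))"
    using Q.ar_Ident[of ?N] by (simp add: Q_eq_frac)
  have "?g \<cdot>\<^bsub>AC\<^esub> frac (Ident A ?M) p (Ident A ?N) = frac (Ident A ?M) p p"
  proof (rule Comp_frac)
    show "rep_comp A C (Ident A ?N, Ident A ?N, p) (Ident A ?M, p, Ident A ?N) (Ident A ?M, p, p)"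
      by (rule rep_compI[where a = "Ident A ?M" and b = "Ident A ?N" and I = ?N
            and e = "Ident A ?N" and m = "Ident A ?N" and u = p and w = "Ident A ?N"])
        (simp_all add: Hom_iff)
  qed (simp_all add: in_reps_iff)
  also have "\<dots> = frac (Ident A ?M) (Ident A ?M) (Ident A ?M)"
  proof (rule frac_eqI)
    have "stage_map A C (Ident A ?M, Ident A ?M, Ident A ?M) (Ident A ?M, p, p)"
      by (rule stage_mapI[where a = "Ident A ?M" and b = p]) (simp_all add: Hom_iff)
    moreover have "stage_map A C (Ident A ?M, p, p) (Ident A ?M, p, p)"
      by (rule stage_map_refl[of _ _ _ ?M ?M]) (simp add: in_reps_iff)
    ultimately show "rep_equiv A C (Ident A ?M, p, p) (Ident A ?M, Ident A ?M, Ident A ?M)"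
      unfolding rep_equiv_def by blast
  qed (simp_all add: in_reps_iff)
  finally show "?g \<cdot>\<^bsub>AC\<^esub> Q p = Ident AC (Dom AC (Q p))"
    using Q.ar_Ident[of ?M] by (simp add: Q_eq_frac)
qed

text \<open>Equal elements of the direct limit agree at a later stage. This is the way back from an
  equation in \<open>A / C\<close> to one in \<open>A\<close>, at the price of \<open>k\<close> and
  \<open>r\<close>.\<close>

lemma Q_eqD:
  assumes "Q f = Q g" "f \<in> Arr A" "g \<in> Arr A" "Dom A f = Dom A g" "Cod A f = Cod A g"
  obtains k r where "sub_mod_in A C k" "quot_by_in A C r" "Cod A k = Dom A g" "Dom A r = Cod A g"
    "r \<cdot> (f \<cdot> k) = r \<cdot> (g \<cdot> k)"
proof -
  let ?M = "Dom A g" and ?N = "Cod A g"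
  have "rep_equiv A C (Ident A ?M, f, Ident A ?N) (Ident A ?M, g, Ident A ?N)"
    by (rule frac_eqD[of _ _ _ _ _ _ ?M ?N]) (use assms in \<open>simp_all add: Q_eq_frac in_reps_iff\<close>)
  then obtain k h r where "stage_map A C (Ident A ?M, f, Ident A ?N) (k, h, r)"
      "stage_map A C (Ident A ?M, g, Ident A ?N) (k, h, r)"
    unfolding rep_equiv_def by auto
  then show thesis
    using that[of k r] stage_map_IdentD[of f k h r] stage_map_IdentD[of g k h r] assms by simp
qed

text \<open>For \<open>M\<close> in \<open>C\<close> the zero subobject is an admissible index,
  because its quotient is \<open>M\<close>; restricted to it, all endomorphisms of \<open>M\<close>
  coincide. The equation is a way to say that \<open>Q M\<close> is zero without an additive
  structure on \<open>A / C\<close>.\<close>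

lemma Q_Ident_thick:
  assumes M: "M \<in> C"
  shows "Q (Ident A M) = Q (zero M M)"
proof -
  obtain z where z: "zero_object A z"
    using zero_object_ex by blast
  let ?k = "zero z M"
  have M': "M \<in> Obj A"
    using M thick_Obj by blast
  have k: "sub_mod_in A C ?k"
    using is_kernel_zero_Ident[OF z M'] by (rule sub_mod_in_kernel) (use M M' in simp)
  have "stage_map A C (Ident A M, f, Ident A M) (?k, ?k, Ident A M)"
    if "f \<in> Arr A" "Dom A f = M" "Cod A f = M" for f
    by (rule stage_mapI[where a = ?k and b = "Ident A M"])
      (use M' k that zero_object_Obj[OF z] in \<open>simp_all add: Hom_iff\<close>)
  then have "rep_equiv A C (Ident A M, Ident A M, Ident A M) (Ident A M, zero M M, Ident A M)"
    unfolding rep_equiv_def using M' by (intro exI[of _ "(?k, ?k, Ident A M)"]) simp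
  then have "frac (Ident A M) (Ident A M) (Ident A M) = frac (Ident A M) (zero M M) (Ident A M)"
    using M' by (intro frac_eqI[of _ _ _ M M]) (simp_all add: in_reps_iff)
  then show ?thesis
    using M' by (simp add: Q_eq_frac)
qed

end

section \<open>The section functor and saturated objects\<close>

locale section_functor = serre A add zero C +
  adj: adjunction A "serre_quotient A C" "quotient_functor A C" S \<eta> \<delta>
  for A :: "('o, 'a) cat" (structure) and add zero C S \<eta> \<delta>
begin

text \<open>As \<open>Q\<close> is the identity on objects, the object part of the same endofunctor
  is just \<open>ob S\<close>.\<close>

abbreviation W :: "'a \<Rightarrow> 'a" where
  "W f \<equiv> ar S (Q f)"

lemma eta_arr [simp]: "x \<in> Obj A \<Longrightarrow> \<eta> x \<in> Arr A"
  and Dom_eta [simp]: "x \<in> Obj A \<Longrightarrow> Dom A (\<eta> x) = x"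
  and Cod_eta [simp]: "x \<in> Obj A \<Longrightarrow> Cod A (\<eta> x) = ob S x"
  using adj.unit.component[of x] by (simp_all add: Hom_iff id_fun_def comp_fun_def)

lemma delta_arr [simp]: "y \<in> Obj A \<Longrightarrow> \<delta> y \<in> Arr AC"
  and Dom_delta [simp]: "y \<in> Obj A \<Longrightarrow> Dom AC (\<delta> y) = ob S y"
  and Cod_delta [simp]: "y \<in> Obj A \<Longrightarrow> Cod AC (\<delta> y) = y"
  using adj.counit.component[of y] by (simp_all add: Hom_iff id_fun_def comp_fun_def)

lemma S_Obj [simp]: "y \<in> Obj A \<Longrightarrow> ob S y \<in> Obj A"
  using adj.G.ob_closed by simp

lemma Dom_Q [simp]: "f \<in> Arr A \<Longrightarrow> Dom AC (Q f) = Dom A f"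
  and Cod_Q [simp]: "f \<in> Arr A \<Longrightarrow> Cod AC (Q f) = Cod A f"
  by simp_all

lemma eta_natural: "f \<in> Arr A \<Longrightarrow> W f \<cdot> \<eta> (Dom A f) = \<eta> (Cod A f) \<cdot> f"
  using adj.unit.naturality[of f] by (simp add: Hom_iff id_fun_def comp_fun_def)

lemma delta_Q_eta: "x \<in> Obj A \<Longrightarrow> \<delta> x \<cdot>\<^bsub>AC\<^esub> Q (\<eta> x) = Ident AC x"
  using adj.triangle_left[of x] by simp

lemma S_delta_eta: "y \<in> Obj A \<Longrightarrow> ar S (\<delta> y) \<cdot> \<eta> (ob S y) = Ident A (ob S y)"
  using adj.triangle_right[of y] by simp

text \<open>
  Naturality of \<open>Q \<eta>\<close> extends from the image of \<open>Q\<close> to all of \<open>A / C\<close>, since every arrow of \<open>A / C\<close> is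
  a fraction.
\<close>

lemma Q_eta_natural:
  assumes \<phi>: "\<phi> \<in> Arr AC"
  shows "Q (\<eta> (Cod AC \<phi>)) \<cdot>\<^bsub>AC\<^esub> \<phi> = Q (ar S \<phi>) \<cdot>\<^bsub>AC\<^esub> Q (\<eta> (Dom AC \<phi>))"
proof -
  obtain i f p where ifp: "sub_mod_in A C i" "quot_by_in A C p" and f: "f \<in> Arr A" "Dom A f = Dom A i"
    "Cod A f = Cod A p" and eq: "\<phi> = frac i f p"
    using \<phi> by (rule fracE)
  note [simp] = ifp f \<phi>
  let ?M' = "Dom A i" and ?M = "Cod A i" and ?N = "Dom A p" and ?N' = "Cod A p"
  have [simp]: "Dom AC \<phi> = ?M" "Cod AC \<phi> = ?N"
    by (simp_all add: eq)
  have nat: "Q (W g) \<cdot>\<^bsub>AC\<^esub> Q (\<eta> (Dom A g)) = Q (\<eta> (Cod A g)) \<cdot>\<^bsub>AC\<^esub> Q g" if "g \<in> Arr A" for g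
    using that eta_natural[of g] by (simp flip: Q.ar_Comp_arr)
  have Qf: "Q p \<cdot>\<^bsub>AC\<^esub> (\<phi> \<cdot>\<^bsub>AC\<^esub> Q i) = Q f"
    using Q_frac_Q eq by simp
  have Wf: "Q (W f) = Q (W p) \<cdot>\<^bsub>AC\<^esub> (Q (ar S \<phi>) \<cdot>\<^bsub>AC\<^esub> Q (W i))"
    by (simp add: Qf[symmetric] adj.G.ar_Comp_arr Q.ar_Comp_arr)
  \<comment> \<open>The two sides of the claim are compared after composing with
    \<open>Q (W p)\<close> on the left and with \<open>Q i\<close> on the right. This clears the
    denominators of \<open>\<phi>\<close> and leaves naturality at \<open>p\<close>,
    \<open>f\<close> and \<open>i\<close>. Both extra factors are invertible and can be cancelled
    afterwards.\<close>
  have "Q (W p) \<cdot>\<^bsub>AC\<^esub> ((Q (\<eta> ?N) \<cdot>\<^bsub>AC\<^esub> \<phi>) \<cdot>\<^bsub>AC\<^esub> Q i) = (Q (W p) \<cdot>\<^bsub>AC\<^esub> Q (\<eta> ?N)) \<cdot>\<^bsub>AC\<^esub> (\<phi> \<cdot>\<^bsub>AC\<^esub> Q i)"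
    by simp
  also have "\<dots> = (Q (\<eta> ?N') \<cdot>\<^bsub>AC\<^esub> Q p) \<cdot>\<^bsub>AC\<^esub> (\<phi> \<cdot>\<^bsub>AC\<^esub> Q i)"
    using nat[of p] by simp
  also have "\<dots> = Q (\<eta> ?N') \<cdot>\<^bsub>AC\<^esub> (Q p \<cdot>\<^bsub>AC\<^esub> (\<phi> \<cdot>\<^bsub>AC\<^esub> Q i))"
    by simp
  also have "\<dots> = Q (W f) \<cdot>\<^bsub>AC\<^esub> Q (\<eta> ?M')"
    using nat[of f] by (simp add: Qf)
  also have "\<dots> = Q (W p) \<cdot>\<^bsub>AC\<^esub> (Q (ar S \<phi>) \<cdot>\<^bsub>AC\<^esub> (Q (W i) \<cdot>\<^bsub>AC\<^esub> Q (\<eta> ?M')))"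
    by (simp add: Wf)
  also have "\<dots> = Q (W p) \<cdot>\<^bsub>AC\<^esub> ((Q (ar S \<phi>) \<cdot>\<^bsub>AC\<^esub> Q (\<eta> ?M)) \<cdot>\<^bsub>AC\<^esub> Q i)"
    using nat[of i] by simp
  finally have "(Q (\<eta> ?N) \<cdot>\<^bsub>AC\<^esub> \<phi>) \<cdot>\<^bsub>AC\<^esub> Q i = (Q (ar S \<phi>) \<cdot>\<^bsub>AC\<^esub> Q (\<eta> ?M)) \<cdot>\<^bsub>AC\<^esub> Q i"
    by (rule Q.B.is_mono_cancel[rotated])
      (simp_all add: Q.B.is_iso_is_mono Q.is_iso_ar adj.G.is_iso_ar is_iso_Q_quot_by_in)
  then have "Q (\<eta> ?N) \<cdot>\<^bsub>AC\<^esub> \<phi> = Q (ar S \<phi>) \<cdot>\<^bsub>AC\<^esub> Q (\<eta> ?M)"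
    by (rule Q.B.is_epi_cancel[rotated]) (simp_all add: Q.B.is_iso_is_epi is_iso_Q_sub_mod_in)
  then show ?thesis
    by simp
qed

text \<open>One triangle identity makes \<open>\<delta> x\<close> a left inverse. On the other side,
  naturality at the arrow \<open>\<delta> x\<close> turns the composite into the image under
  \<open>Q\<close> of the other triangle identity.\<close>

lemma is_iso_Q_eta:
  assumes x: "x \<in> Obj A"
  shows "is_iso AC (Q (\<eta> x))"
proof (rule Q.B.is_isoI[where g = "\<delta> x"])
  have "Q (\<eta> x) \<cdot>\<^bsub>AC\<^esub> \<delta> x = Q (ar S (\<delta> x)) \<cdot>\<^bsub>AC\<^esub> Q (\<eta> (ob S x))"
    using Q_eta_natural[of "\<delta> x"] x by simp
  also have "\<dots> = Q (Ident A (ob S x))"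
    using x S_delta_eta[OF x] by (simp flip: Q.ar_Comp_arr)
  finally show "Q (\<eta> x) \<cdot>\<^bsub>AC\<^esub> \<delta> x = Ident AC (Cod AC (Q (\<eta> x)))"
    using x Q.ar_Ident[of "ob S x"] by simp
qed (use x delta_Q_eta in simp_all)

text \<open>This is one half of the adjunction bijection: an arrow into \<open>ob S y\<close> is
  recovered from its transpose, hence from its domain and its image under \<open>Q\<close>.\<close>

lemma transpose:
  assumes "f \<in> Arr A" "Cod A f = ob S y" "y \<in> Obj A"
  shows "ar S (\<delta> y \<cdot>\<^bsub>AC\<^esub> Q f) \<cdot> \<eta> (Dom A f) = f"
proof -
  have "ar S (\<delta> y \<cdot>\<^bsub>AC\<^esub> Q f) \<cdot> \<eta> (Dom A f) = ar S (\<delta> y) \<cdot> (W f \<cdot> \<eta> (Dom A f))"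
    using assms by (simp add: adj.G.ar_Comp_arr)
  also have "\<dots> = (ar S (\<delta> y) \<cdot> \<eta> (ob S y)) \<cdot> f"
    using assms eta_natural[of f] by simp
  also have "\<dots> = f"
    using assms by (simp only: S_delta_eta Ident_Comp_arr)
  finally show ?thesis .
qed

lemma Q_inject:
  assumes "Q f = Q g" "f \<in> Arr A" "g \<in> Arr A" "Cod A f = ob S y" "Cod A g = ob S y" "y \<in> Obj A"
  shows "f = g"
proof -
  have "Dom AC (Q f) = Dom AC (Q g)"
    by (simp only: assms(1))
  then have dom: "Dom A f = Dom A g"
    using assms(2,3) by simp
  have "f = ar S (\<delta> y \<cdot>\<^bsub>AC\<^esub> Q f) \<cdot> \<eta> (Dom A f)"
    using transpose[OF assms(2,4,6)] by (rule sym)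
  also have "\<dots> = ar S (\<delta> y \<cdot>\<^bsub>AC\<^esub> Q g) \<cdot> \<eta> (Dom A g)"
    by (simp only: assms(1) dom)
  also have "\<dots> = g"
    using assms(3,5,6) by (rule transpose)
  finally show ?thesis .
qed

section \<open>Locality of the objects in the image of \<open>S\<close>\<close>

lemma local_unique:
  assumes "is_iso AC (Q u)" "u \<in> Arr A" "g \<cdot> u = h \<cdot> u" "g \<in> Arr A" "h \<in> Arr A"
    "Dom A g = Cod A u" "Dom A h = Cod A u" "Cod A g = ob S y" "Cod A h = ob S y" "y \<in> Obj A"
  shows "g = h"
proof -
  have "Q g \<cdot>\<^bsub>AC\<^esub> Q u = Q h \<cdot>\<^bsub>AC\<^esub> Q u"
    using assms by (simp flip: Q.ar_Comp_arr)
  then have "Q g = Q h"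
    using assms Q.B.is_epi_cancel[OF Q.B.is_iso_is_epi, of "Q u" "Q g" "Q h"] by simp
  then show ?thesis
    using Q_inject assms by blast
qed

lemma local_ex:
  assumes u: "is_iso AC (Q u)" "u \<in> Arr A"
    and f: "f \<in> Arr A" "Dom A f = Dom A u" "Cod A f = ob S y" "y \<in> Obj A"
  obtains g where "g \<in> Arr A" "Dom A g = Cod A u" "Cod A g = ob S y" "g \<cdot> u = f"
proof -
  obtain v where v: "v \<in> Arr AC" "Dom AC v = Cod A u" "Cod AC v = Dom A u"
    "v \<cdot>\<^bsub>AC\<^esub> Q u = Ident AC (Dom A u)"
    using u Q.B.is_isoE[OF u(1)] by (metis Dom_Q Cod_Q)
  \<comment> \<open>With \<open>v\<close> a left inverse of \<open>Q u\<close>, the arrow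
    \<open>Q f \<cdot> v\<close> is the extension in \<open>A / C\<close>; \<open>?g\<close> is its
    transport to \<open>A\<close> by the adjunction.\<close>
  let ?\<phi> = "\<delta> y \<cdot>\<^bsub>AC\<^esub> (Q f \<cdot>\<^bsub>AC\<^esub> v)"
  let ?g = "ar S ?\<phi> \<cdot> \<eta> (Cod A u)"
  have "?g \<cdot> u = ar S ?\<phi> \<cdot> (\<eta> (Cod A u) \<cdot> u)"
    using u(2) f v(1-3) by simp
  also have "\<dots> = ar S ?\<phi> \<cdot> (W u \<cdot> \<eta> (Dom A u))"
    using eta_natural[OF u(2)] by simp
  also have "\<dots> = ar S (?\<phi> \<cdot>\<^bsub>AC\<^esub> Q u) \<cdot> \<eta> (Dom A u)"
    using u(2) f v(1-3) by (simp add: adj.G.ar_Comp_arr)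
  also have "?\<phi> \<cdot>\<^bsub>AC\<^esub> Q u = \<delta> y \<cdot>\<^bsub>AC\<^esub> Q f"
    using u(2) f v by simp
  also have "ar S (\<delta> y \<cdot>\<^bsub>AC\<^esub> Q f) \<cdot> \<eta> (Dom A u) = f"
    using transpose[of f y] f by simp
  finally show thesis
    using that[of ?g] u(2) f v(1-3) by simp
qed

lemma Q_zero_if_thick:
  assumes "f \<in> Arr A" "Dom A f \<in> C"
  shows "Q f = Q (zero (Dom A f) (Cod A f))"
proof -
  have "Q (f \<cdot> Ident A (Dom A f)) = Q (f \<cdot> zero (Dom A f) (Dom A f))"
    using assms Q_Ident_thick[OF assms(2)] by (simp add: Q.ar_Comp_arr del: Comp_Ident_arr Comp_zero)
  then show ?thesis
    using assms by simp
qed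

lemma zero_if_thick:
  assumes "f \<in> Arr A" "Dom A f \<in> C" "Cod A f = ob S y" "y \<in> Obj A"
  shows "f = zero (Dom A f) (ob S y)"
  using Q_inject[OF Q_zero_if_thick[OF assms(1,2)]] assms by simp

text \<open>For \<open>M\<close> in \<open>C\<close> the arrow \<open>\<eta> M\<close> is zero. So
  the identity and the zero endomorphism of \<open>ob S M\<close> agree after
  \<open>\<eta> M\<close>, and uniqueness of extensions makes them equal.\<close>

lemma zero_object_S:
  assumes M: "M \<in> C"
  shows "zero_object A (ob S M)"
proof -
  have M': "M \<in> Obj A"
    using M thick_Obj by blast
  have "\<eta> M = zero M (ob S M)"
    using zero_if_thick[of "\<eta> M" M] M M' by simp
  then have "Ident A (ob S M) \<cdot> \<eta> M = zero (ob S M) (ob S M) \<cdot> \<eta> M"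
    using M' by simp
  then have "Ident A (ob S M) = zero (ob S M) (ob S M)"
    by (rule local_unique[where y = M, OF is_iso_Q_eta[OF M'], rotated]) (use M' in simp_all)
  then show ?thesis
    using M' by (simp add: zero_object_iff)
qed

lemma saturated_S:
  assumes y: "y \<in> Obj A"
  shows "saturated A C (ob S y)"
  unfolding saturated_def
proof (intro conjI allI impI)
  fix i
  assume "is_mono A i \<and> Cod A i = ob S y \<and> Dom A i \<in> C"
  then have i: "is_mono A i" "Cod A i = ob S y" "Dom A i \<in> C" "i \<in> Arr A"
    using is_mono_arr by auto
  \<comment> \<open>An arrow from an object of \<open>C\<close> into \<open>ob S y\<close> vanishes,
    and a mono that is zero has a zero domain.\<close>
  have "i \<cdot> Ident A (Dom A i) = i \<cdot> zero (Dom A i) (Dom A i)"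
    using zero_if_thick[of i y] i y by simp
  then have "Ident A (Dom A i) = zero (Dom A i) (Dom A i)"
    using is_mono_cancel[OF i(1)] i by simp
  then show "zero_object A (Dom A i)"
    using i by (simp add: zero_object_iff)
next
  fix i p
  assume "short_exact A i p \<and> Dom A i = ob S y \<and> Cod A p \<in> C"
  then have ip: "is_kernel A i p" "is_cokernel A p i" "Dom A i = ob S y" and s: "sub_mod_in A C i"
    by (auto simp: short_exact_def sub_mod_in_def)
  note iD = is_kernelD[OF ip(1)] and pe = is_cokernelD(5)[OF ip(2)]
  \<comment> \<open>The cokernel of \<open>i\<close> lies in \<open>C\<close>, so \<open>Q i\<close>
    is invertible and the identity of \<open>ob S y\<close> extends along \<open>i\<close>; the
    extension is the retraction.\<close>
  obtain r where r: "r \<in> Arr A" "Dom A r = Cod A i" "Cod A r = ob S y" "r \<cdot> i = Ident A (ob S y)"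
    using local_ex[OF is_iso_Q_sub_mod_in[OF s], of "Ident A (ob S y)" y] iD ip(3) y by auto
  let ?E = "Dom A p"
  have ir: "Ident A ?E \<in> Arr A" "i \<cdot> r \<in> Arr A" "Dom A (Ident A ?E) = Dom A (i \<cdot> r)"
    "Cod A (Ident A ?E) = Cod A (i \<cdot> r)"
    using iD(1-3) r(1-3) ip(3) by simp_all
  have D: "Dom A (i \<cdot> r) = ?E" "Cod A (i \<cdot> r) = ?E"
    using iD(1-3) r(1-3) ip(3) by simp_all
  \<comment> \<open>The section comes from \<open>d = Ident A ?E - i \<cdot> r\<close>: it kills
    \<open>i\<close>, so it descends along \<open>p\<close> to an arrow \<open>s\<close>, and
    \<open>p \<cdot> d = p\<close> yields \<open>p \<cdot> s = Ident A (Cod A p)\<close> because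
    \<open>p\<close> is epi.\<close>
  obtain d where d: "d \<in> Arr A" "Dom A d = ?E" "Cod A d = ?E"
    "d = zero ?E ?E \<longleftrightarrow> Ident A ?E = i \<cdot> r"
    "\<And>h. h \<in> Arr A \<Longrightarrow> Dom A h = ?E \<Longrightarrow> h \<cdot> d = zero ?E (Cod A h) \<longleftrightarrow> h \<cdot> Ident A ?E = h \<cdot> (i \<cdot> r)"
    "\<And>h. h \<in> Arr A \<Longrightarrow> Cod A h = ?E \<Longrightarrow> d \<cdot> h = zero (Dom A h) ?E \<longleftrightarrow> Ident A ?E \<cdot> h = (i \<cdot> r) \<cdot> h"
    "\<And>h. h \<in> Arr A \<Longrightarrow> Dom A h = ?E \<Longrightarrow> h \<cdot> (i \<cdot> r) = zero ?E (Cod A h) \<Longrightarrow>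
      h \<cdot> d = h \<cdot> Ident A ?E"
    by (rule differenceE[OF ir, unfolded D]) (rule that)
  have "(i \<cdot> r) \<cdot> i = i"
    using iD(1-3) r ip(3) by simp
  then have "d \<cdot> i = zero (Dom A i) (Cod A d)"
    using d(3) d(6)[of i] iD(1,3) by simp
  then obtain s where s: "s \<in> Arr A" "Dom A s = Cod A p" "Cod A s = ?E" "s \<cdot> p = d"
    using is_cokernel_factorE[OF ip(2), of d] d(1-3) iD(3) by auto
  have "p \<cdot> (i \<cdot> r) = (p \<cdot> i) \<cdot> r"
    using iD(1-3) r(1-3) ip(3) by simp
  also have "\<dots> = zero ?E (Cod A p)"
    unfolding iD(4) using iD(1-3) r(1-3) ip(3) by simp
  finally have "p \<cdot> d = p"
    using d(7)[of p] iD(2) by simp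
  then have "(p \<cdot> s) \<cdot> p = Ident A (Cod A p) \<cdot> p"
    using s iD(2) by simp
  then have "p \<cdot> s = Ident A (Cod A p)"
    using is_epi_cancel[OF pe, of "p \<cdot> s" "Ident A (Cod A p)"] s(1-3) iD(2) by simp
  then show "splits A i p"
    unfolding splits_def using r s(1-3) ip(3)
    by (intro conjI bexI[of _ r] bexI[of _ s]) (simp_all add: Hom_iff)
qed (use y in simp)

text \<open>Cancelling \<open>Q u\<close> shows that \<open>Q n\<close> equals the image of zero.
  Hence some subobject \<open>k\<close> of \<open>Dom A n\<close> with quotient in \<open>C\<close>
  is mapped by \<open>n\<close> into the kernel of some \<open>r\<close>, and this kernel lies in
  \<open>C\<close>. As \<open>n \<cdot> k\<close> is mono, \<open>Dom A k\<close> is in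
  \<open>C\<close>, and \<open>Dom A n\<close> is an extension of two objects of
  \<open>C\<close>.\<close>

lemma Dom_kernel_thick:
  assumes u: "u \<in> Arr A" "is_mono AC (Q u)" and n: "is_kernel A n u"
  shows "Dom A n \<in> C"
proof -
  note nD = is_kernelD[OF n]
  have "u \<cdot> n = u \<cdot> zero (Dom A n) (Dom A u)"
    using nD by simp
  then have "Q u \<cdot>\<^bsub>AC\<^esub> Q n = Q u \<cdot>\<^bsub>AC\<^esub> Q (zero (Dom A n) (Dom A u))"
    using nD(1-3) u(1) by (simp flip: Q.ar_Comp_arr del: Comp_zero)
  then have "Q n = Q (zero (Dom A n) (Dom A u))"
    using Q.B.is_mono_cancel[OF u(2), of "Q n" "Q (zero (Dom A n) (Dom A u))"] nD(1-3) by simp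
  then obtain k r where kr: "sub_mod_in A C k" "quot_by_in A C r" "Cod A k = Dom A n"
    "Dom A r = Dom A u" "r \<cdot> (n \<cdot> k) = r \<cdot> (zero (Dom A n) (Dom A u) \<cdot> k)"
    by (rule Q_eqD) (use nD(1-3) in auto)
  have r0: "r \<cdot> (n \<cdot> k) = zero (Dom A k) (Cod A r)"
    using kr nD(1-3) by simp
  obtain l where l: "is_kernel A l r" "Dom A l \<in> C"
    using kr(2) by (auto simp: quot_by_in_def short_exact_def)
  obtain t where t: "t \<in> Arr A" "Dom A t = Dom A k" "Cod A t = Dom A l" "l \<cdot> t = n \<cdot> k"
    using is_kernel_factorE[OF l(1), of "n \<cdot> k"] r0 nD(1-3) kr(1-4) by auto
  have "is_mono A (l \<cdot> t)"
    unfolding t(4) using nD(5) kr(1,3) by (intro is_mono_Comp) (simp_all add: sub_mod_in_is_mono)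
  then have "is_mono A t"
    by (rule is_mono_right) (use is_kernelD(1)[OF l(1)] t(1,3) in simp_all)
  then have "Dom A k \<in> C"
    using Dom_mono_thick[of t] t l(2) by simp
  then show ?thesis
    using kr(1,3) thick_iff unfolding sub_mod_in_def by metis
qed

text \<open>Dually, some quotient \<open>r\<close> of \<open>Cod A c\<close> with kernel in
  \<open>C\<close> is reached by an epi from the cokernel of some \<open>k\<close>, and this
  cokernel lies in \<open>C\<close>. So \<open>Cod A c\<close> is again an extension of two objects
  of \<open>C\<close>.\<close>

lemma Cod_cokernel_thick:
  assumes u: "u \<in> Arr A" "is_epi AC (Q u)" and c: "is_cokernel A c u"
  shows "Cod A c \<in> C"
proof -
  note cD = is_cokernelD[OF c]
  have "c \<cdot> u = zero (Cod A u) (Cod A c) \<cdot> u"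
    using cD by simp
  then have "Q c \<cdot>\<^bsub>AC\<^esub> Q u = Q (zero (Cod A u) (Cod A c)) \<cdot>\<^bsub>AC\<^esub> Q u"
    using cD(1-3) u(1) by (simp flip: Q.ar_Comp_arr del: zero_Comp)
  then have "Q c = Q (zero (Cod A u) (Cod A c))"
    using Q.B.is_epi_cancel[OF u(2), of "Q c" "Q (zero (Cod A u) (Cod A c))"] cD(1-3) by simp
  then obtain k r where kr: "sub_mod_in A C k" "quot_by_in A C r" "Cod A k = Cod A u"
    "Dom A r = Cod A c" "r \<cdot> (c \<cdot> k) = r \<cdot> (zero (Cod A u) (Cod A c) \<cdot> k)"
    by (rule Q_eqD) (use cD(1-3) in auto)
  have r0: "(r \<cdot> c) \<cdot> k = zero (Dom A k) (Cod A r)"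
    using kr cD(1-3) by simp
  obtain l where l: "is_cokernel A l k" "Cod A l \<in> C"
    using kr(1) by (auto simp: sub_mod_in_def short_exact_def)
  obtain t where t: "t \<in> Arr A" "Dom A t = Cod A l" "Cod A t = Cod A r" "t \<cdot> l = r \<cdot> c"
    using is_cokernel_factorE[OF l(1), of "r \<cdot> c"] r0 cD(1-3) kr(1-4) by auto
  have "is_epi A (t \<cdot> l)"
    unfolding t(4) using cD(5) kr(2,4) by (intro is_epi_Comp) (simp_all add: quot_by_in_is_epi)
  then have "is_epi A t"
    by (rule is_epi_left) (use is_cokernelD(1)[OF l(1)] t(1,2) in simp_all)
  then have "Cod A r \<in> C"
    using Cod_epi_thick[of t] t l(2) by simp
  moreover obtain j where "short_exact A j r" "Dom A j \<in> C"
    using kr(2) by (auto simp: quot_by_in_def)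
  ultimately have "Cod A j \<in> C" "Cod A j = Cod A c"
    using thick_iff[of j r] is_kernelD(3)[of j r] kr(4) by (simp_all add: short_exact_def)
  then show ?thesis
    by simp
qed

text \<open>Kernel and cokernel of \<open>\<eta> M\<close> lie in \<open>C\<close>. The first
  condition of saturation makes the kernel zero, the second splits the resulting sequence. The
  retraction is a two-sided inverse by uniqueness of extensions along \<open>\<eta> M\<close>
  itself.\<close>

lemma is_iso_eta_saturated:
  assumes M: "saturated A C M"
  shows "is_iso A (\<eta> M)"
proof -
  have M': "M \<in> Obj A"
    using M by (simp add: saturated_def)
  note [simp] = M' and iso = is_iso_Q_eta[OF M']
  obtain n where n: "is_kernel A n (\<eta> M)"
    using kernel_ex by fastforce
  note nD = is_kernelD[OF n]
  have "Dom A n \<in> C"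
    using Dom_kernel_thick[OF _ Q.B.is_iso_is_mono[OF iso] n] by simp
  then have z: "zero_object A (Dom A n)"
    using M nD(3,5) by (simp add: saturated_def)
  have "is_mono A (\<eta> M)"
  proof (rule is_monoI_zero)
    fix h
    assume h: "h \<in> Arr A" "Cod A h = Dom A (\<eta> M)" "\<eta> M \<cdot> h = zero (Dom A h) (Cod A (\<eta> M))"
    then obtain v where v: "v \<in> Arr A" "Dom A v = Dom A h" "Cod A v = Dom A n" "n \<cdot> v = h"
      using is_kernel_factorE[OF n] by metis
    have "v = zero (Dom A h) (Dom A n)"
      using to_zero_object[OF z, of v] v by simp
    then have "n \<cdot> v = zero (Dom A h) (Dom A (\<eta> M))"
      using nD(1,3) h(1) by simp
    then show "h = zero (Dom A h) (Dom A (\<eta> M))"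
      using v(4) by simp
  qed simp
  then obtain c where c: "short_exact A (\<eta> M) c"
    by (rule mono_short_exact)
  have "Cod A c \<in> C"
    using Cod_cokernel_thick[OF _ Q.B.is_iso_is_epi[OF iso]] c by (simp add: short_exact_def)
  then have "splits A (\<eta> M) c"
    using M c by (simp add: saturated_def)
  then obtain r where r: "r \<in> Arr A" "Dom A r = ob S M" "Cod A r = M" "r \<cdot> \<eta> M = Ident A M"
    by (auto simp: splits_def Hom_iff)
  have "(\<eta> M \<cdot> r) \<cdot> \<eta> M = Ident A (ob S M) \<cdot> \<eta> M"
    using r by simp
  then have "\<eta> M \<cdot> r = Ident A (ob S M)"
    using local_unique[OF iso, of "\<eta> M \<cdot> r" "Ident A (ob S M)" M] r(1-3) by simp
  then show ?thesis
    using r by (intro is_isoI[where g = r]) simp_all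
qed

text \<open>Both arrows agree after \<open>\<eta> M\<close>, by naturality of \<open>\<eta>\<close>
  at the arrow \<open>\<eta> M\<close>.\<close>

lemma eta_S:
  assumes M: "M \<in> Obj A"
  shows "\<eta> (ob S M) = W (\<eta> M)"
  using local_unique[OF is_iso_Q_eta[OF M], of "\<eta> (ob S M)" "W (\<eta> M)" "ob S M"]
    eta_natural[of "\<eta> M"] M by simp

text \<open>A saturated \<open>X\<close> is isomorphic to \<open>ob S X\<close> through
  \<open>\<eta> X\<close>, so it inherits locality. The passage to arbitrary saturated objects
  matters because these are the test objects in \<open>Sat A C\<close>.\<close>

lemma saturated_unique:
  assumes X: "saturated A C X" and u: "is_iso AC (Q u)" "u \<in> Arr A"
    and gh: "g \<cdot> u = h \<cdot> u" "g \<in> Arr A" "h \<in> Arr A"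
      "Dom A g = Cod A u" "Dom A h = Cod A u" "Cod A g = X" "Cod A h = X"
  shows "g = h"
proof -
  have X': "X \<in> Obj A"
    using X by (simp add: saturated_def)
  have "(\<eta> X \<cdot> g) \<cdot> u = (\<eta> X \<cdot> h) \<cdot> u"
    using X' u(2) gh by simp
  then have "\<eta> X \<cdot> g = \<eta> X \<cdot> h"
    using local_unique[OF u, of "\<eta> X \<cdot> g" "\<eta> X \<cdot> h" X] X' gh(2-) by simp
  then show ?thesis
    using is_mono_cancel[OF is_iso_is_mono[OF is_iso_eta_saturated[OF X]]] X' gh by simp
qed

lemma saturated_ex:
  assumes X: "saturated A C X" and u: "is_iso AC (Q u)" "u \<in> Arr A"
    and f: "f \<in> Arr A" "Dom A f = Dom A u" "Cod A f = X"
  obtains g where "g \<in> Arr A" "Dom A g = Cod A u" "Cod A g = X" "g \<cdot> u = f"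
proof -
  have X': "X \<in> Obj A"
    using X by (simp add: saturated_def)
  obtain r where r: "r \<in> Arr A" "Dom A r = ob S X" "Cod A r = X" "r \<cdot> \<eta> X = Ident A X"
    using is_isoE[OF is_iso_eta_saturated[OF X]] X' by (metis Dom_eta Cod_eta)
  obtain g where g: "g \<in> Arr A" "Dom A g = Cod A u" "Cod A g = ob S X" "g \<cdot> u = \<eta> X \<cdot> f"
    using local_ex[OF u, of "\<eta> X \<cdot> f" X] f X' by auto
  have "(r \<cdot> g) \<cdot> u = r \<cdot> (\<eta> X \<cdot> f)"
    using r(1-3) g u(2) by simp
  also have "\<dots> = (r \<cdot> \<eta> X) \<cdot> f"
    using r(1-3) f X' by simp
  also have "\<dots> = f"
    unfolding r(4) using f by simp
  finally show thesis
    using that[of "r \<cdot> g"] r g by simp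
qed

end

section \<open>Exactness of the Gabriel monad\<close>

lemma cfunctor_full_subcategory:
  assumes "cfunctor A B F" "X \<subseteq> Obj B" "\<And>x. x \<in> Obj A \<Longrightarrow> ob F x \<in> X"
  shows "cfunctor A (full_subcategory B X) F"
proof -
  interpret cfunctor A B F
    by fact
  show ?thesis
    by (intro cfunctor.intro cfunctor_axioms.intro A.category_axioms B.category_full_subcategory)
      (use assms(2,3) in \<open>auto simp: Hom_iff ar_Ident ar_Comp_arr\<close>)
qed

lemma Sat_simps [simp]:
  "Obj (Sat A C) = {M. saturated A C M}"
  "Dom (Sat A C) = Dom A"
  "Cod (Sat A C) = Cod A"
  "Ident (Sat A C) = Ident A"
  "Comp (Sat A C) = Comp A"
  "f \<in> Arr (Sat A C) \<longleftrightarrow> f \<in> Arr A \<and> saturated A C (Dom A f) \<and> saturated A C (Cod A f)"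
  by (simp_all add: Sat_def)

lemma cfunctor_Sat:
  assumes "cfunctor B A F" "\<And>x. x \<in> Obj B \<Longrightarrow> saturated A C (ob F x)"
  shows "cfunctor B (Sat A C) F"
  unfolding Sat_def using assms by (intro cfunctor_full_subcategory) (auto simp: saturated_def)

context section_functor
begin

text \<open>Additivity of \<open>S\<close> does not enter: both sides become zero after
  \<open>\<eta> x\<close>, and extensions are unique.\<close>

lemma W_zero:
  assumes x: "x \<in> Obj A" "y \<in> Obj A"
  shows "W (zero x y) = zero (ob S x) (ob S y)"
proof (rule local_unique[where y = y, OF is_iso_Q_eta[OF x(1)]])
  show "W (zero x y) \<cdot> \<eta> x = zero (ob S x) (ob S y) \<cdot> \<eta> x"
    using eta_natural[of "zero x y"] x by simp
qed (use x in simp_all)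

text \<open>
  The kernel \<open>k\<close> of \<open>W p\<close> is isomorphic to \<open>W i\<close> because \<open>\<eta> \<cdot> i\<close> factors through \<open>k\<close> by an arrow that
  \<open>Q\<close> inverts. That arrow decomposes as \<open>M' \<rightarrow> Y \<rightarrow> L \<rightarrow> K\<close>, where \<open>Y\<close> and \<open>L\<close> are the preimages of \<open>K\<close>
  in \<open>M\<close> and in the image of \<open>\<eta>\<close>.
\<close>

lemma is_kernel_W:
  assumes ip: "short_exact A i p"
  shows "is_kernel A (W i) (W p)"
proof -
  have ik: "is_kernel A i p"
    using ip by (simp add: short_exact_def)
  note iD = is_kernelD[OF ik]
  let ?M' = "Dom A i" and ?M = "Cod A i" and ?M'' = "Cod A p"
  let ?\<eta> = "\<eta> ?M"
  note [simp] = iD(1,2) iD(3)[symmetric]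
  have nat_i: "W i \<cdot> \<eta> ?M' = ?\<eta> \<cdot> i" and nat_p: "W p \<cdot> ?\<eta> = \<eta> ?M'' \<cdot> p"
    using eta_natural[of i] eta_natural[of p] by simp_all
  have Wpi: "W p \<cdot> W i = zero (ob S ?M') (ob S ?M'')"
    using iD(4) W_zero[of ?M' ?M''] by (simp flip: Q.ar_Comp_arr adj.G.ar_Comp_arr)
  obtain m e where me: "is_mono A m" "is_epi A e" "Cod A e = Dom A m" "m \<cdot> e = ?\<eta>"
    by (rule image_factorization[of ?\<eta>]) simp_all
  have [simp]: "m \<in> Arr A" "e \<in> Arr A" "Cod A e = Dom A m"
    using me is_mono_arr is_epi_arr by auto
  have [simp]: "Cod A m = ob S ?M" "Dom A e = ?M"
    using arg_cong[OF me(4), of "Cod A"] arg_cong[OF me(4), of "Dom A"] by simp_all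
  have Qme: "Q m \<cdot>\<^bsub>AC\<^esub> Q e = Q ?\<eta>"
    by (simp add: me(4) flip: Q.ar_Comp_arr)
  \<comment> \<open>Factoring the invertible \<open>Q ?\<eta>\<close> leaves \<open>Q m\<close> epi
    and \<open>Q e\<close> mono. These halves suffice to put the cokernel of \<open>m\<close> and
    the kernel of \<open>e\<close> into \<open>C\<close>.\<close>
  have Qm: "is_epi AC (Q m)"
    by (rule Q.B.is_epi_left[of _ "Q e"]) (simp_all add: Qme Q.B.is_iso_is_epi is_iso_Q_eta)
  have Qe: "is_mono AC (Q e)"
    by (rule Q.B.is_mono_right[of "Q m"]) (simp_all add: Qme Q.B.is_iso_is_mono is_iso_Q_eta)
  obtain k where k: "is_kernel A k (W p)"
    using kernel_ex[of "W p"] by auto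
  have [simp]: "k \<in> Arr A" "Cod A k = ob S ?M"
    using is_kernelD[OF k] by simp_all
  have Wpk: "W p \<cdot> k = zero (Dom A k) (ob S ?M'')"
    using is_kernelD(4)[OF k] by simp
  have k_mono: "is_mono A k"
    using is_kernelD(5)[OF k] .
  obtain l where l: "is_kernel A l (W p \<cdot> m)"
    using kernel_ex[of "W p \<cdot> m"] by auto
  have [simp]: "l \<in> Arr A" "Cod A l = Dom A m"
    using is_kernelD[OF l] by simp_all
  have Wpml: "W p \<cdot> (m \<cdot> l) = zero (Dom A l) (ob S ?M'')"
    using is_kernelD(4)[OF l] by simp
  obtain y where y: "is_kernel A y ((W p \<cdot> m) \<cdot> e)"
    using kernel_ex[of "(W p \<cdot> m) \<cdot> e"] by auto
  \<comment> \<open>Naturality describes the preimage of the kernel of \<open>W p\<close> in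
    \<open>?M\<close> in two ways: through \<open>e\<close> it is related to \<open>l\<close>, and
    through \<open>p\<close> it is related to \<open>i\<close>.\<close>
  have eq: "(W p \<cdot> m) \<cdot> e = \<eta> ?M'' \<cdot> p"
    using nat_p by (simp add: me(4))
  have y': "is_kernel A y (\<eta> ?M'' \<cdot> p)"
    using y unfolding eq .
  have [simp]: "y \<in> Arr A" "Cod A y = ?M"
    using is_kernelD[OF y'] by simp_all
  have y_mono: "is_mono A y"
    using is_kernelD(5)[OF y] .

  obtain j where j: "j \<in> Arr A" "Dom A j = Dom A l" "Cod A j = Dom A k" "k \<cdot> j = m \<cdot> l"
    using is_kernel_factorE[OF k, of "m \<cdot> l"] Wpml by auto
  obtain t where t: "t \<in> Arr A" "Dom A t = Dom A y" "Cod A t = Dom A l" "l \<cdot> t = e \<cdot> y"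
    using is_kernel_factorE[OF l, of "e \<cdot> y"] is_kernelD(4)[OF y] by auto
  have "(\<eta> ?M'' \<cdot> p) \<cdot> i = zero ?M' (ob S ?M'')"
    using iD(4) by simp
  then obtain i' where i': "i' \<in> Arr A" "Dom A i' = ?M'" "Cod A i' = Dom A y" "y \<cdot> i' = i"
    using is_kernel_factorE[OF y', of i] by auto
  note [simp] = j(1-3) t(1-3) i'(1-3)

  \<comment> \<open>The subobject \<open>j\<close> is the intersection of \<open>k\<close> with the
    image \<open>m\<close> of \<open>?\<eta>\<close>. It is therefore the kernel of \<open>k\<close>
    followed by the cokernel of \<open>m\<close>, whose codomain is in \<open>C\<close>.\<close>
  have "sub_mod_in A C j"
  proof -
    obtain c where c: "short_exact A m c"
      using me(1) by (rule mono_short_exact)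
    then have mc: "is_kernel A m c" and cm: "is_cokernel A c m"
      by (simp_all add: short_exact_def)
    note cD = is_kernelD[OF mc]
    have [simp]: "c \<in> Arr A" "Dom A c = ob S ?M"
      using cD by simp_all
    have "is_kernel A j (c \<cdot> k)"
    proof (rule is_kernelI)
      have "is_mono A (k \<cdot> j)"
        unfolding j(4) using me(1) is_kernelD(5)[OF l] by (intro is_mono_Comp) simp_all
      then show "is_mono A j"
        by (rule is_mono_right) simp_all
      have "(c \<cdot> k) \<cdot> j = c \<cdot> (m \<cdot> l)"
        using j(4) by simp
      also have "\<dots> = (c \<cdot> m) \<cdot> l"
        by simp
      also have "\<dots> = zero (Dom A j) (Cod A (c \<cdot> k))"
        unfolding cD(4) by simp
      finally show "(c \<cdot> k) \<cdot> j = zero (Dom A j) (Cod A (c \<cdot> k))" .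
    next
      fix h
      assume h: "h \<in> Arr A" "Cod A h = Dom A (c \<cdot> k)" "(c \<cdot> k) \<cdot> h = zero (Dom A h) (Cod A (c \<cdot> k))"
      then have [simp]: "Cod A h = Dom A k"
        by simp
      note [simp] = h(1)
      obtain h1 where h1: "h1 \<in> Arr A" "Dom A h1 = Dom A h" "Cod A h1 = Dom A m" "m \<cdot> h1 = k \<cdot> h"
        using is_kernel_factorE[OF mc, of "k \<cdot> h"] h(3) by auto
      note [simp] = h1(1-3)
      have "(W p \<cdot> m) \<cdot> h1 = (W p \<cdot> k) \<cdot> h"
        using h1(4) by simp
      also have "\<dots> = zero (Dom A h1) (Cod A (W p \<cdot> m))"
        unfolding Wpk by simp
      finally obtain h2 where h2: "h2 \<in> Arr A" "Dom A h2 = Dom A h" "Cod A h2 = Dom A l" "l \<cdot> h2 = h1"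
        using is_kernel_factorE[OF l, of h1] by auto
      note [simp] = h2(1-3)
      have "k \<cdot> (j \<cdot> h2) = (m \<cdot> l) \<cdot> h2"
        using Comp_eq_assoc[OF j(4), of h2] by simp
      also have "\<dots> = k \<cdot> h"
        using h2(4) h1(4) by simp
      finally have "j \<cdot> h2 = h"
        using is_mono_cancel[OF k_mono, of "j \<cdot> h2" h] by simp
      then show "\<exists>u \<in> Arr A. Dom A u = Dom A h \<and> Cod A u = Dom A j \<and> j \<cdot> u = h"
        by (intro bexI[of _ h2]) simp_all
    qed simp_all
    moreover have "Cod A c \<in> C"
      using Cod_cokernel_thick[OF _ Qm cm] by simp
    ultimately show ?thesis
      using sub_mod_in_kernel[of j "c \<cdot> k"] by simp
  qed
  then have j_iso: "is_iso AC (Q j)"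
    by (rule is_iso_Q_sub_mod_in)

  \<comment> \<open>As a map between preimages along the epi \<open>e\<close>, the arrow
    \<open>t\<close> is epi; through \<open>y\<close> its kernel embeds into the kernel of
    \<open>e\<close>, which is in \<open>C\<close>.\<close>
  have "quot_by_in A C t"
  proof -
    obtain n where n: "is_kernel A n t"
      using kernel_ex[of t] by auto
    have [simp]: "n \<in> Arr A" "Cod A n = Dom A y"
      using is_kernelD[OF n] by simp_all
    have tn: "t \<cdot> n = zero (Dom A n) (Dom A l)"
      using is_kernelD(4)[OF n] by simp
    obtain z where z: "is_kernel A z e"
      using kernel_ex[of e] by auto
    have [simp]: "z \<in> Arr A" "Cod A z = ?M"
      using is_kernelD[OF z] by simp_all
    have "e \<cdot> (y \<cdot> n) = l \<cdot> (t \<cdot> n)"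
      using Comp_eq_assoc[OF t(4), of n] by simp
    also have "\<dots> = zero (Dom A n) (Dom A m)"
      unfolding tn by simp
    finally obtain b where b: "b \<in> Arr A" "Dom A b = Dom A n" "Cod A b = Dom A z" "z \<cdot> b = y \<cdot> n"
      using is_kernel_factorE[OF z, of "y \<cdot> n"] by auto
    note [simp] = b(1-3)
    have "is_mono A (z \<cdot> b)"
      unfolding b(4) using y_mono is_kernelD(5)[OF n] by (intro is_mono_Comp) simp_all
    then have "is_mono A b"
      by (rule is_mono_right) simp_all
    moreover have "Dom A z \<in> C"
      using Dom_kernel_thick[OF _ Qe z] by simp
    ultimately have "Dom A n \<in> C"
      using Dom_mono_thick[of b] by simp
    moreover have "is_epi A t"
      by (rule epi_on_kernels[OF me(2) y l]) (use t(4) in simp_all)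
    ultimately show ?thesis
      using n quot_by_in_epi by blast
  qed
  then have t_iso: "is_iso AC (Q t)"
    by (rule is_iso_Q_quot_by_in)

  \<comment> \<open>On the preimage \<open>y\<close> the arrow \<open>p\<close> takes values in the
    kernel of \<open>\<eta> ?M''\<close>, an object of \<open>C\<close>, and \<open>i'\<close> is
    the kernel of the resulting arrow \<open>g\<close>.\<close>
  have "sub_mod_in A C i'"
  proof -
    obtain n where n: "is_kernel A n (\<eta> ?M'')"
      using kernel_ex[of "\<eta> ?M''"] by auto
    have [simp]: "n \<in> Arr A" "Cod A n = ?M''"
      using is_kernelD[OF n] by simp_all
    have "\<eta> ?M'' \<cdot> (p \<cdot> y) = zero (Dom A y) (ob S ?M'')"
      using is_kernelD(4)[OF y'] by simp
    then obtain g where g: "g \<in> Arr A" "Dom A g = Dom A y" "Cod A g = Dom A n" "n \<cdot> g = p \<cdot> y"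
      using is_kernel_factorE[OF n, of "p \<cdot> y"] by auto
    note [simp] = g(1-3)
    have "is_kernel A i' g"
    proof (rule is_kernelI)
      have "is_mono A (y \<cdot> i')"
        unfolding i'(4) by (rule iD(5))
      then show "is_mono A i'"
        by (rule is_mono_right) simp_all
      have "n \<cdot> (g \<cdot> i') = p \<cdot> (y \<cdot> i')"
        using Comp_eq_assoc[OF g(4), of i'] by simp
      also have "\<dots> = n \<cdot> zero (Dom A i') (Dom A n)"
        unfolding i'(4) using iD(4) by simp
      finally show "g \<cdot> i' = zero (Dom A i') (Cod A g)"
        using is_mono_cancel[OF is_kernelD(5)[OF n], of "g \<cdot> i'" "zero (Dom A i') (Dom A n)"] by simp
    next
      fix h
      assume h: "h \<in> Arr A" "Cod A h = Dom A g" "g \<cdot> h = zero (Dom A h) (Cod A g)"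
      then have [simp]: "Cod A h = Dom A y"
        by simp
      note [simp] = h(1)
      have "p \<cdot> (y \<cdot> h) = n \<cdot> (g \<cdot> h)"
        using Comp_eq_assoc[OF g(4), of h] by simp
      also have "\<dots> = zero (Dom A h) ?M''"
        unfolding h(3) by simp
      finally obtain h1 where h1: "h1 \<in> Arr A" "Dom A h1 = Dom A h" "Cod A h1 = ?M'" "i \<cdot> h1 = y \<cdot> h"
        using is_kernel_factorE[OF ik, of "y \<cdot> h"] by auto
      note [simp] = h1(1-3)
      have "y \<cdot> (i' \<cdot> h1) = y \<cdot> h"
        using Comp_eq_assoc[OF i'(4), of h1] h1(4) by simp
      then have "i' \<cdot> h1 = h"
        using is_mono_cancel[OF y_mono, of "i' \<cdot> h1" h] by simp
      then show "\<exists>u \<in> Arr A. Dom A u = Dom A h \<and> Cod A u = Dom A i' \<and> i' \<cdot> u = h"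
        by (intro bexI[of _ h1]) simp_all
    qed simp_all
    moreover have "Dom A n \<in> C"
      using Dom_kernel_thick[OF _ Q.B.is_iso_is_mono[OF is_iso_Q_eta] n] by simp
    ultimately show ?thesis
      using sub_mod_in_kernel[of i' g] by simp
  qed
  then have i'_iso: "is_iso AC (Q i')"
    by (rule is_iso_Q_sub_mod_in)

  let ?a = "j \<cdot> (t \<cdot> i')"
  have a_iso: "is_iso AC (Q ?a)"
    using j_iso t_iso i'_iso by (simp add: Q.ar_Comp_arr Q.B.is_iso_Comp)
  have "k \<cdot> ?a = (k \<cdot> j) \<cdot> (t \<cdot> i')"
    by simp
  also have "\<dots> = m \<cdot> ((l \<cdot> t) \<cdot> i')"
    unfolding j(4) by simp
  also have "\<dots> = (m \<cdot> e) \<cdot> (y \<cdot> i')"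
    unfolding t(4) by simp
  also have "\<dots> = ?\<eta> \<cdot> i"
    unfolding me(4) i'(4) ..
  finally have ka: "k \<cdot> ?a = ?\<eta> \<cdot> i" .

  \<comment> \<open>The inverse of the comparison arrow \<open>v\<close> from
    \<open>ob S ?M'\<close> to the kernel of \<open>W p\<close> is constructed before
    \<open>v\<close>: it is the extension of \<open>\<eta> ?M'\<close> along
    \<open>?a\<close>.\<close>
  obtain s where s: "s \<in> Arr A" "Dom A s = Dom A k" "Cod A s = ob S ?M'" "s \<cdot> ?a = \<eta> ?M'"
    using local_ex[OF a_iso, of "\<eta> ?M'" ?M'] by auto
  note [simp] = s(1-3)
  have "(W i \<cdot> s) \<cdot> ?a = W i \<cdot> (s \<cdot> ?a)"
    by simp
  also have "\<dots> = k \<cdot> ?a"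
    unfolding s(4) ka nat_i ..
  finally have Wis: "W i \<cdot> s = k"
    by (rule local_unique[where y = ?M, OF a_iso, rotated]) simp_all
  obtain v where v: "v \<in> Arr A" "Dom A v = ob S ?M'" "Cod A v = Dom A k" "k \<cdot> v = W i"
    using is_kernel_factorE[OF k, of "W i"] Wpi by auto
  note [simp] = v(1-3)
  have "k \<cdot> (v \<cdot> \<eta> ?M') = k \<cdot> ?a"
    using Comp_eq_assoc[OF v(4), of "\<eta> ?M'"] unfolding ka nat_i by simp
  then have va: "v \<cdot> \<eta> ?M' = ?a"
    using is_mono_cancel[OF k_mono, of "v \<cdot> \<eta> ?M'" ?a] by simp
  have "(s \<cdot> v) \<cdot> \<eta> ?M' = s \<cdot> (v \<cdot> \<eta> ?M')"
    by simp
  also have "\<dots> = Ident A (ob S ?M') \<cdot> \<eta> ?M'"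
    unfolding va s(4) by simp
  finally have sv: "s \<cdot> v = Ident A (ob S ?M')"
    by (rule local_unique[where y = ?M' and u = "\<eta> ?M'", rotated 2]) (simp_all add: is_iso_Q_eta)
  show ?thesis
  proof (rule is_kernelI)
    have "is_mono A v"
      by (rule is_monoI_retraction[of _ s]) (use sv in simp_all)
    then show "is_mono A (W i)"
      unfolding v(4)[symmetric] using k_mono by (intro is_mono_Comp) simp_all
    show "W p \<cdot> W i = zero (Dom A (W i)) (Cod A (W p))"
      using Wpi by simp
  next
    fix h
    assume h: "h \<in> Arr A" "Cod A h = Dom A (W p)" "W p \<cdot> h = zero (Dom A h) (Cod A (W p))"
    then obtain h1 where h1: "h1 \<in> Arr A" "Dom A h1 = Dom A h" "Cod A h1 = Dom A k" "k \<cdot> h1 = h"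
      using is_kernel_factorE[OF k] by metis
    have "W i \<cdot> (s \<cdot> h1) = h"
      using Comp_eq_assoc[OF Wis, of h1] h1 by simp
    then show "\<exists>u \<in> Arr A. Dom A u = Dom A h \<and> Cod A u = Dom A (W i) \<and> W i \<cdot> u = h"
      using h1(1-3) by (intro bexI[of _ "s \<cdot> h1"]) simp_all
  qed simp_all
qed

lemma zero_object_Sat_iff: "zero_object (Sat A C) z \<longleftrightarrow> zero_object A z \<and> saturated A C z"
proof
  assume z: "zero_object (Sat A C) z"
  then have sat: "saturated A C z"
    by (simp add: zero_object_def)
  then have "z \<in> Obj A"
    by (simp add: saturated_def)
  moreover from this sat have "Ident A z \<in> Hom (Sat A C) z z" "zero z z \<in> Hom (Sat A C) z z"
    by (simp_all add: Hom_iff)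
  moreover have "\<exists>!f. f \<in> Hom (Sat A C) z z"
    using z sat by (simp add: zero_object_def)
  ultimately show "zero_object A z \<and> saturated A C z"
    using sat zero_object_iff by blast
next
  assume z: "zero_object A z \<and> saturated A C z"
  have "Hom (Sat A C) x w = Hom A x w" if "saturated A C x" "saturated A C w" for x w
    using that by (auto simp: Hom_iff)
  then show "zero_object (Sat A C) z"
    using z by (simp add: zero_object_def saturated_def)
qed

text \<open>A zero arrow of \<open>A\<close> has to be factored inside the subcategory. The object
  \<open>ob S z0\<close> for a zero object \<open>z0\<close> serves, being both zero and
  saturated.\<close>

lemma zero_arrow_Sat_iff:
  assumes f: "f \<in> Arr (Sat A C)"
  shows "zero_arrow (Sat A C) f \<longleftrightarrow> zero_arrow A f"
proof
  assume "zero_arrow (Sat A C) f"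
  then obtain z u v where z: "zero_object (Sat A C) z" "u \<in> Hom (Sat A C) (Dom A f) z"
      "v \<in> Hom (Sat A C) z (Cod A f)" "f = v \<cdot> u"
    unfolding zero_arrow_def Sat_simps by (elim conjE exE bexE)
  moreover have "u \<in> Hom A (Dom A f) z" "v \<in> Hom A z (Cod A f)"
    using z(2,3) by (simp_all add: Hom_iff)
  ultimately show "zero_arrow A f"
    unfolding zero_arrow_def using f zero_object_Sat_iff by auto
next
  assume z: "zero_arrow A f"
  obtain z0 where z0: "zero_object A z0"
    using zero_object_ex by blast
  let ?z = "ob S z0"
  have zo: "zero_object (Sat A C) ?z"
    using zero_object_S[OF zero_object_thick[OF z0]] saturated_S[OF zero_object_Obj[OF z0]]
    by (simp add: zero_object_Sat_iff)
  have zz: "?z \<in> Obj A" "saturated A C ?z"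
    using saturated_S[OF zero_object_Obj[OF z0]] by (simp_all add: saturated_def)
  have "zero ?z (Cod A f) \<cdot> zero (Dom A f) ?z = f"
    using z zz by (simp add: zero_arrow_iff)
  then show "zero_arrow (Sat A C) f"
    unfolding zero_arrow_def using f zo zz
    by (intro conjI exI[of _ ?z] bexI[of _ "zero (Dom A f) ?z"] bexI[of _ "zero ?z (Cod A f)"])
      (simp_all add: Hom_iff)
qed

text \<open>Passing to a full subcategory only removes test objects, and zero arrows are the same.
  The dual passage is of no help for \<open>W p\<close>, which need not be a cokernel in
  \<open>A\<close>.\<close>

lemma is_kernel_Sat:
  assumes kf: "is_kernel A k f" and k: "k \<in> Arr (Sat A C)" and f: "f \<in> Arr (Sat A C)"
  shows "is_kernel (Sat A C) k f"
  unfolding is_kernel_def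
proof (intro conjI allI ballI impI)
  note kD = is_kernelD[OF kf]
  show "Cod (Sat A C) k = Dom (Sat A C) f"
    using kD by simp
  show "zero_arrow (Sat A C) (f \<cdot>\<^bsub>Sat A C\<^esub> k)"
    using zero_arrow_Sat_iff[of "f \<cdot> k"] kD k f by (simp add: zero_arrow_iff)
  fix x h
  assume h: "h \<in> Hom (Sat A C) x (Dom (Sat A C) f)" "zero_arrow (Sat A C) (f \<cdot>\<^bsub>Sat A C\<^esub> h)"
  then have "h \<in> Hom A x (Dom A f)" "zero_arrow A (f \<cdot> h)"
    using zero_arrow_Sat_iff[of "f \<cdot> h"] f by (auto simp: Hom_iff)
  then have ex: "\<exists>!u. u \<in> Hom A x (Dom A k) \<and> k \<cdot> u = h"
    using kf[unfolded is_kernel_def, THEN conjunct2, THEN conjunct2, THEN conjunct2, THEN conjunct2,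
        THEN spec, THEN bspec, THEN mp] by simp
  moreover have "u \<in> Hom (Sat A C) x (Dom A k) \<longleftrightarrow> u \<in> Hom A x (Dom A k)" for u
    using h(1) k by (auto simp: Hom_iff)
  ultimately show "\<exists>!u. u \<in> Hom (Sat A C) x (Dom (Sat A C) k) \<and> k \<cdot>\<^bsub>Sat A C\<^esub> u = h"
    by simp
qed (use k f in simp_all)

text \<open>An arrow from \<open>ob S ?M\<close> to a saturated \<open>X\<close> that kills
  \<open>W i\<close> is restricted along \<open>\<eta> ?M\<close>, descends along \<open>p\<close>
  and extends along \<open>\<eta> ?M''\<close>. Each of the three passages is unique, which gives
  both existence and uniqueness.\<close>

lemma is_cokernel_W:
  assumes ip: "short_exact A i p"
  shows "is_cokernel (Sat A C) (W p) (W i)"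
proof -
  have pc: "is_cokernel A p i"
    using ip by (simp add: short_exact_def)
  note pD = is_cokernelD[OF pc]
  let ?M' = "Dom A i" and ?M = "Cod A i" and ?M'' = "Cod A p"
  note [simp] = pD(1-3) saturated_S
  have nat_i: "W i \<cdot> \<eta> ?M' = \<eta> ?M \<cdot> i" and nat_p: "W p \<cdot> \<eta> ?M = \<eta> ?M'' \<cdot> p"
    using eta_natural[of i] eta_natural[of p] by simp_all
  have Wpi: "W p \<cdot> W i = zero (ob S ?M') (ob S ?M'')"
    using pD(4) W_zero[of ?M' ?M''] by (simp flip: Q.ar_Comp_arr adj.G.ar_Comp_arr)
  show ?thesis
    unfolding is_cokernel_def
  proof (intro conjI allI ballI impI)
    show "zero_arrow (Sat A C) (W p \<cdot>\<^bsub>Sat A C\<^esub> W i)"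
      using zero_arrow_Sat_iff[of "W p \<cdot> W i"] Wpi by (simp add: zero_arrow_iff)
    fix X h
    assume "h \<in> Hom (Sat A C) (Cod (Sat A C) (W i)) X" "zero_arrow (Sat A C) (h \<cdot>\<^bsub>Sat A C\<^esub> W i)"
    then have h: "h \<in> Arr A" "Dom A h = ob S ?M" "Cod A h = X" "saturated A C X"
        "h \<cdot> W i = zero (ob S ?M') X"
      using zero_arrow_Sat_iff[of "h \<cdot> W i"] by (auto simp: Hom_iff zero_arrow_iff)
    note [simp] = h(1-3)
    have X [simp]: "X \<in> Obj A"
      using h(4) by (simp add: saturated_def)
    have "(h \<cdot> \<eta> ?M) \<cdot> i = (h \<cdot> W i) \<cdot> \<eta> ?M'"
      using nat_i by simp
    also have "\<dots> = zero ?M' X"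
      unfolding h(5) by simp
    finally obtain g where g: "g \<in> Arr A" "Dom A g = ?M''" "Cod A g = X" "g \<cdot> p = h \<cdot> \<eta> ?M"
      using is_cokernel_factorE[OF pc, of "h \<cdot> \<eta> ?M"] by auto
    note [simp] = g(1-3)
    obtain u where u: "u \<in> Arr A" "Dom A u = ob S ?M''" "Cod A u = X" "u \<cdot> \<eta> ?M'' = g"
      using saturated_ex[OF h(4) is_iso_Q_eta[of ?M''], of g] by auto
    note [simp] = u(1-3)
    have W_eta: "(w \<cdot> W p) \<cdot> \<eta> ?M = (w \<cdot> \<eta> ?M'') \<cdot> p" if "w \<in> Arr A" "Dom A w = ob S ?M''" for w
      using that nat_p by simp
    have "(u \<cdot> W p) \<cdot> \<eta> ?M = h \<cdot> \<eta> ?M"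
      using W_eta[of u] unfolding u(4) g(4) by simp
    then have uh: "u \<cdot> W p = h"
      using saturated_unique[OF h(4) is_iso_Q_eta[of ?M], of "u \<cdot> W p" h] by simp
    have unique: "w = u" if w: "w \<in> Arr A" "Dom A w = ob S ?M''" "Cod A w = X" "w \<cdot> W p = h" for w
    proof -
      have "(w \<cdot> \<eta> ?M'') \<cdot> p = (u \<cdot> \<eta> ?M'') \<cdot> p"
        using W_eta[of w] W_eta[of u] w(1,2) unfolding w(4) uh by simp
      then have "w \<cdot> \<eta> ?M'' = u \<cdot> \<eta> ?M''"
        using is_epi_cancel[OF pD(5), of "w \<cdot> \<eta> ?M''" "u \<cdot> \<eta> ?M''"] w(1-3) by simp
      then show ?thesis
        using saturated_unique[OF h(4) is_iso_Q_eta[of ?M''], of w u] w(1-3) by simp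
    qed
    show "\<exists>!w. w \<in> Hom (Sat A C) (Cod (Sat A C) (W p)) X \<and> w \<cdot>\<^bsub>Sat A C\<^esub> W p = h"
      by (rule ex1I[of _ u]) (use unique uh h(4) in \<open>simp_all add: Hom_iff\<close>)
  qed simp_all
qed

lemma exact_functor_Sat: "exact_functor A (Sat A C) (S \<circ>\<^sub>F quotient_functor A C)"
  unfolding exact_functor_def
proof (intro conjI allI impI)
  show "cfunctor A (Sat A C) (S \<circ>\<^sub>F quotient_functor A C)"
    using adj.unit.G.cfunctor_axioms by (rule cfunctor_Sat) (simp add: comp_fun_def saturated_S)
  fix i p
  assume ip: "short_exact A i p"
  then have "i \<in> Arr A" "p \<in> Arr A"
    using is_kernelD(1,2)[of i p] by (simp_all add: short_exact_def)
  then have "is_kernel (Sat A C) (W i) (W p)"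
    by (intro is_kernel_Sat is_kernel_W[OF ip]) (simp_all add: saturated_S)
  then show "short_exact (Sat A C) (ar (S \<circ>\<^sub>F quotient_functor A C) i)
      (ar (S \<circ>\<^sub>F quotient_functor A C) p)"
    using is_cokernel_W[OF ip] by (simp add: short_exact_def comp_fun_def)
qed

lemma saturating_endofunctor_gabriel:
  "saturating_endofunctor A C (S \<circ>\<^sub>F quotient_functor A C) \<eta>"
  unfolding saturating_endofunctor_def
proof (intro conjI ballI allI impI)
  show "cfunctor A A (S \<circ>\<^sub>F quotient_functor A C)"
    by (rule adj.unit.G.cfunctor_axioms)
  show "nat_trans A A id_fun (S \<circ>\<^sub>F quotient_functor A C) \<eta>"
    by (rule adj.unit.nat_trans_axioms)
  show "exact_functor A (Sat A C) (S \<circ>\<^sub>F quotient_functor A C)"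
    by (rule exact_functor_Sat)
qed (simp_all add: comp_fun_def zero_object_S saturated_S eta_S is_iso_eta_saturated)

text \<open>The factorization through \<open>A / C\<close> is the section functor itself, since all
  its values are saturated.\<close>

lemma is_colift_gabriel: "is_colift A C (S \<circ>\<^sub>F quotient_functor A C) S"
proof -
  have "cfunctor AC (Sat A C) S"
    using adj.G.cfunctor_axioms by (rule cfunctor_Sat) (simp add: saturated_S)
  then show ?thesis
    unfolding is_colift_def factors_through_quotient_def
    by (intro exI[of _ S]) (simp add: fun_eq_def id_fun_def comp_fun_def)
qed

end

section \<open>Monads of adjunctions\<close>

text \<open>The unit laws are the triangle identities; associativity is the image under
  \<open>G\<close> of naturality of \<open>\<delta>\<close> at the arrow
  \<open>\<delta> (ob F x)\<close>.\<close>

lemma (in adjunction) monad_adjunction: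
  "monad A \<lparr>endo = G \<circ>\<^sub>F F, munit = \<eta>, mmult = (\<lambda>x. ar G (\<delta> (ob F x)))\<rparr>" (is "monad A ?T")
proof -
  have eta: "\<eta> x \<in> Arr A" "Dom A (\<eta> x) = x" "Cod A (\<eta> x) = ob G (ob F x)" if "x \<in> Obj A" for x
    using unit.component[OF that] by (simp_all add: Hom_iff id_fun_def comp_fun_def)
  have delta: "\<delta> y \<in> Arr B" "Dom B (\<delta> y) = ob F (ob G y)" "Cod B (\<delta> y) = y" if "y \<in> Obj B" for y
    using counit.component[OF that] by (simp_all add: Hom_iff id_fun_def comp_fun_def)
  have nat: "\<phi> \<cdot>\<^bsub>B\<^esub> \<delta> (Dom B \<phi>) = \<delta> (Cod B \<phi>) \<cdot>\<^bsub>B\<^esub> ar F (ar G \<phi>)" if "\<phi> \<in> Arr B" for \<phi>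
    using counit.naturality[of \<phi>] that by (simp add: Hom_iff id_fun_def comp_fun_def)
  note [simp] = eta delta F.ob_closed G.ob_closed
  have GF: "cfunctor A A (G \<circ>\<^sub>F F)"
    by (rule unit.G.cfunctor_axioms)
  have GFGF: "cfunctor A A (G \<circ>\<^sub>F F \<circ>\<^sub>F (G \<circ>\<^sub>F F))"
    by (intro cfunctor.intro cfunctor_axioms.intro unit.F.A.category_axioms)
      (auto simp: comp_fun_def Hom_iff F.ar_Ident G.ar_Ident F.ar_Comp_arr G.ar_Comp_arr)
  have mult: "nat_trans A A (G \<circ>\<^sub>F F \<circ>\<^sub>F (G \<circ>\<^sub>F F)) (G \<circ>\<^sub>F F) (\<lambda>x. ar G (\<delta> (ob F x)))"
  proof (intro nat_trans.intro nat_trans_axioms.intro GF GFGF)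
    fix f x y
    assume "f \<in> Hom A x y"
    then have f: "f \<in> Arr A" "Dom A f = x" "Cod A f = y"
      by (auto simp: Hom_iff)
    then have "x \<in> Obj A" "y \<in> Obj A"
      by auto
    then show "ar (G \<circ>\<^sub>F F) f \<cdot>\<^bsub>A\<^esub> ar G (\<delta> (ob F x))
        = ar G (\<delta> (ob F y)) \<cdot>\<^bsub>A\<^esub> ar (G \<circ>\<^sub>F F \<circ>\<^sub>F (G \<circ>\<^sub>F F)) f"
      using nat[of "ar F f"] f by (simp add: comp_fun_def flip: G.ar_Comp_arr)
  qed (simp add: comp_fun_def Hom_iff)
  show ?thesis
  proof (intro monad.intro monad_axioms.intro)
    fix x
    assume x: "x \<in> Obj A"
    show "mmult ?T x \<cdot>\<^bsub>A\<^esub> munit ?T (ob (endo ?T) x) = Ident A (ob (endo ?T) x)"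
      using x triangle_right[of "ob F x"] by (simp add: comp_fun_def)
    show "mmult ?T x \<cdot>\<^bsub>A\<^esub> ar (endo ?T) (munit ?T x) = Ident A (ob (endo ?T) x)"
      using x triangle_left[of x] by (simp add: comp_fun_def G.ar_Ident flip: G.ar_Comp_arr)
    show "mmult ?T x \<cdot>\<^bsub>A\<^esub> mmult ?T (ob (endo ?T) x) = mmult ?T x \<cdot>\<^bsub>A\<^esub> ar (endo ?T) (mmult ?T x)"
      using x nat[of "\<delta> (ob F x)"] by (simp add: comp_fun_def flip: G.ar_Comp_arr)
  qed (use mult in \<open>simp_all add: unit.nat_trans_axioms\<close>)
qed

text \<open>Functors that agree on the carriers may differ as records. Identity arrows form the
  isomorphism, and the monad laws of \<open>T\<close> are transferred from \<open>T'\<close>,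
  because an equivalence demands them on both sides.\<close>

lemma equivalent_monads_fun_eq:
  assumes T': "monad A T'" and endo: "fun_eq A (endo T) (endo T')"
    and eq: "munit T = munit T'" "mmult T = mmult T'"
  shows "equivalent_monads A T T'"
proof -
  interpret T': monad A T'
    by (rule T')
  have obeq [simp]: "ob (endo T) x = ob (endo T') x" if "x \<in> Obj A" for x
    using endo that by (simp add: fun_eq_def)
  have areq [simp]: "ar (endo T) f = ar (endo T') f" if "f \<in> Arr A" for f
    using endo that by (simp add: fun_eq_def)
  note [simp] = T'.unit.G.ob_closed
  have u: "munit T' x \<in> Arr A" "Dom A (munit T' x) = x" "Cod A (munit T' x) = ob (endo T') x"
    if "x \<in> Obj A" for x
    using T'.unit.component[OF that] by (simp_all add: Hom_iff id_fun_def)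
  have m: "mmult T' x \<in> Arr A" "Dom A (mmult T' x) = ob (endo T') (ob (endo T') x)"
    "Cod A (mmult T' x) = ob (endo T') x" if "x \<in> Obj A" for x
    using T'.mult.component[OF that] by (simp_all add: Hom_iff comp_fun_def)
  note [simp] = u m
  have W: "cfunctor A A (endo T)"
    by (intro cfunctor.intro cfunctor_axioms.intro T'.unit.F.A.category_axioms)
      (auto simp: Hom_iff T'.unit.G.ar_Ident T'.unit.G.ar_Comp_arr)
  have WW: "cfunctor A A (endo T \<circ>\<^sub>F endo T)"
    by (intro cfunctor.intro cfunctor_axioms.intro T'.unit.F.A.category_axioms)
      (auto simp: comp_fun_def Hom_iff T'.unit.G.ar_Ident T'.unit.G.ar_Comp_arr)
  have "monad A T"
  proof (intro monad.intro monad_axioms.intro nat_trans.intro nat_trans_axioms.intro W WW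
      T'.unit.F.cfunctor_axioms)
    fix f x y
    assume f: "f \<in> Hom A x y"
    then have "f \<in> Arr A" "Dom A f = x" "Cod A f = y" "x \<in> Obj A" "y \<in> Obj A"
      by (auto simp: Hom_iff)
    then show "ar (endo T) f \<cdot>\<^bsub>A\<^esub> munit T x = munit T y \<cdot>\<^bsub>A\<^esub> ar id_fun f"
        "ar (endo T) f \<cdot>\<^bsub>A\<^esub> mmult T x = mmult T y \<cdot>\<^bsub>A\<^esub> ar (endo T \<circ>\<^sub>F endo T) f"
      using T'.unit.naturality[OF f] T'.mult.naturality[OF f]
      by (simp_all add: eq id_fun_def comp_fun_def)
  qed (use T'.mult_unit T'.mult_endo_unit T'.mult_mult in
      \<open>simp_all add: eq Hom_iff id_fun_def comp_fun_def\<close>)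
  moreover have "nat_trans A A (endo T) (endo T') (\<lambda>x. Ident A (ob (endo T') x))"
    by (intro nat_trans.intro nat_trans_axioms.intro W T'.unit.G.cfunctor_axioms)
      (auto simp: Hom_iff)
  ultimately show ?thesis
    unfolding equivalent_monads_def using T'
    by (intro conjI exI[of _ "\<lambda>x. Ident A (ob (endo T') x)"])
      (simp_all add: eq T'.unit.F.A.is_iso_Ident T'.unit.G.ar_Ident)
qed

theorem theorem4p6:
  fixes A :: "('o, 'a) cat" and C :: "'o set"
  assumes "abelian_category A"
    and "localizing A C"
  shows "(\<forall>T. gabriel_monad A C T \<longrightarrow> saturating_monad A C T) \<and>
    (\<forall>T. saturating_monad A C T \<longrightarrow>
      (\<exists>T'. gabriel_monad A C T' \<and> equivalent_monads A T T'))"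
proof (intro conjI allI impI)
  fix T
  assume "gabriel_monad A C T"
  then obtain S \<eta> \<delta> where adj: "adjunction A (serre_quotient A C) (quotient_functor A C) S \<eta> \<delta>"
    and T: "T = \<lparr>endo = S \<circ>\<^sub>F quotient_functor A C, munit = \<eta>,
      mmult = (\<lambda>x. ar S (\<delta> (ob (quotient_functor A C) x)))\<rparr>"
    unfolding gabriel_monad_def by blast
  obtain add zero where "abelian A add zero"
    using abelian_category_imp_abelian[OF assms(1)] by blast
  then interpret abelian A add zero .
  interpret adj: adjunction A "serre_quotient A C" "quotient_functor A C" S \<eta> \<delta>
    by (rule adj)
  \<comment> \<open>The adjunction supplies the category laws of \<open>A / C\<close> and the
    functoriality of \<open>Q\<close>; thickness of \<open>C\<close> comes from
    \<open>localizing A C\<close>.\<close>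
  interpret section_functor A add zero C S \<eta> \<delta>
    by unfold_locales (use assms(2) in \<open>simp add: localizing_def\<close>)
  show "saturating_monad A C T"
    unfolding saturating_monad_def
    using saturating_endofunctor_gabriel is_colift_gabriel adj T by blast
next
  fix T
  assume "saturating_monad A C T"
  then obtain W \<eta> H \<delta> where colift: "is_colift A C W H"
    and adj: "adjunction A (serre_quotient A C) (quotient_functor A C) H \<eta> \<delta>"
    and T: "T = \<lparr>endo = W, munit = \<eta>, mmult = (\<lambda>x. ar H (\<delta> (ob (quotient_functor A C) x)))\<rparr>"
    unfolding saturating_monad_def by blast
  let ?T' = "\<lparr>endo = H \<circ>\<^sub>F quotient_functor A C, munit = \<eta>,
    mmult = (\<lambda>x. ar H (\<delta> (ob (quotient_functor A C) x)))\<rparr>"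
  \<comment> \<open>A colift reproduces \<open>W\<close> on objects and arrows of \<open>A\<close>
    only, so the Gabriel monad \<open>?T'\<close> is equivalent to \<open>T\<close> but possibly not
    equal to it.\<close>
  have "fun_eq A W (H \<circ>\<^sub>F quotient_functor A C)"
    using colift
    by (auto simp: is_colift_def factors_through_quotient_def fun_eq_def id_fun_def comp_fun_def)
  then have "equivalent_monads A T ?T'"
    using adjunction.monad_adjunction[OF adj] by (intro equivalent_monads_fun_eq) (simp_all add: T)
  moreover have "gabriel_monad A C ?T'"
    unfolding gabriel_monad_def using adj by blast
  ultimately show "\<exists>T'. gabriel_monad A C T' \<and> equivalent_monads A T T'"
    by blast
qed

end
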